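(* Let $L>0$, $\tau>0$, $\epsilon>0$ and $i\in\mathbb{N}$, $i\ge 1$. Let $\psi_h^{n,0},\psi_h^{n-1}\in V_h$ be given and let $\{\psi_h^{n,j}\}_{j=1}^{i}\subset V_h$ be L-scheme iterates, i.e. for all $j=1,\dots,i$ and all $v_h\in V_h$, $$L(\psi_h^{n,j}-\psi_h^{n,j-1},v_h)+\tau\big(K(\theta(\psi_h^{n,j-1}))\nabla(\psi_h^{n,j}+z),\nabla v_h\big)=\tau(f^n,v_h)-(\theta(\psi_h^{n,j-1})-\theta(\psi_h^{n-1}),v_h).$$ Let $\tilde\psi_h^{n,i+1}\in V_h$ be the solution of the Newton step started from $\psi_h^{n,i}$, i.e. for all $v_h\in V_h$, $$(\theta'(\psi_h^{n,i})(\tilde\psi_h^{n,i+1}-\psi_h^{n,i}),v_h)+\tau\big(K(\theta(\psi_h^{n,i}))\nabla(\tilde\psi_h^{n,i+1}+z),\nabla v_h\big)+\tau\big((K\circ\theta)'(\psi_h^{n,i})\nabla(\psi_h^{n,i}+z)(\tilde\psi_h^{n,i+1}-\psi_h^{n,i}),\nabla v_h\big)=\tau(f^n,v_h)-(\theta(\psi_h^{n,i})-\theta(\psi_h^{n-1}),v_h).$$ Assume there is a constant $C_N^i\in[0,2)$ such that, a.e. in $\Omega$, $$\tau\,\big|K(\theta(\psi_h^{n,i}))^{-\frac12}(K\circ\theta)'(\psi_h^{n,i})\nabla(\psi_h^{n,i}+z)\big|^2\le (C_N^i)^2\,\theta'(\psi_h^{n,i}).$$ Let $\mathcal{T}_{\rm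 deg}^{i,\epsilon}:=\{E\in\mathcal{T}_h:\ \inf_E\theta'(\psi_h^{n,i})<\epsilon\}$ and let $\boldsymbol{\sigma}_L^i\in \mathbf{RT}_p(\mathcal{T}_h)\cap \mathbf{H}(\mathrm{div},\Omega)$ satisfy $$\nabla\cdot\boldsymbol{\sigma}_L^i=\begin{cases}\frac1\tau\Pi_h\big(L(\psi_h^{n,i}-\psi_h^{n,i-1})-(\theta(\psi_h^{n,i})-\theta(\psi_h^{n,i-1}))\big)&\text{in }\mathcal{T}_{\rm deg}^{i,\epsilon},\\ 0&\text{otherwise.}\end{cases}$$ Then $$\left(\int_\Omega \theta'(\psi_h^{n,i})\,|\tilde\psi_h^{n,i+1}-\psi_h^{n,i}|^2+\tau\big|K(\theta(\psi_h^{n,i}))^{\frac12}\nabla(\tilde\psi_h^{n,i+1}-\psi_h^{n,i})\big|^2\right)^{\frac12}\le \eta_{L\to N}^i,$$ where $$\eta_{L\to N}^i:=\frac{2}{2-C_N^i}\left(\big[\eta_{L\to N}^{i,\rm poten}\big]^2+\tau\big[\eta_{L\to N}^{i,\rm flux}\big]^2\right)^{\frac12},$$ $$\eta_{L\to N}^{i,\rm poten}:=\left\|\theta'(\psi_h^{n,i})^{-\frac12}\Big(L(\psi_h^{n,i}-\psi_h^{n,i-1})-\big(\theta(\psi_h^{n,i})-\theta(\psi_h^{n,i-1})\big)\Big)\right\|_{\mathcal{T}_h\setminus\mathcal{T}_{\rm deg}^{i,\epsilon}},$$ $$\eta_{L\to N}^{i,\rm flux}:=\left\|K(\theta(\ps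i_h^{n,i}))^{-\frac12}\Big[\big(K(\theta(\psi_h^{n,i}))-K(\theta(\psi_h^{n,i-1}))\big)\nabla(\psi_h^{n,i}+z)+\boldsymbol{\sigma}_L^i\Big]\right\|.$$
   Context: Domain and spaces. $\Omega\subset\mathbb{R}^d$ is a bounded polygonal (polytopal) domain with Lipschitz boundary; $(\cdot,\cdot)$ and $\|\cdot\|$ are the $L^2(\Omega)$ inner product and norm (also for vector fields). $\mathcal{T}_h$ is a triangulation of $\Omega$ into closed $d$-simplices, $p\in\mathbb{N}$, $\mathcal{P}_p(E)$ is the space of polynomials of order $p$ on $E$, and $\mathcal{P}_p(\mathcal{T}_h)$ the space of functions that are elementwise in $\mathcal{P}_p$. $V_h:=\{v_h\in H_0^1(\Omega): v_h|_E\in\mathcal{P}_p(E)\ \forall E\in\mathcal{T}_h\}$. For a subset $\mathcal{S}\subset\mathcal{T}_h$, $\|\cdot\|_{\mathcal{S}}$ is the $L^2$ norm on the union of the elements in $\mathcal{S}$. $\Pi_h:L^2(\Omega)\to\mathcal{P}_p(\mathcal{T}_h)$ is the $L^2$ projection, $(\Pi_hu,v_h)=(u,v_h)$ for all $v_h\in\mathcal{P}_p(\mathcal{T}_h)$. $\mathbf{RT}_p(\mathcal{T}_h)$ is the $p$-th order (broken) Raviart-Thomas space: $\boldsymbol\sigma|_E\in(\mathcal{P}_p(E))^d+\mathbf{x}\,\mathcal{P}_p(E)$ for all $E\in\mathcal{T}_h$. Data. $z$ is the coordinate (height) function against the direction of gravity. $\theta:\mathbb{R}\to[0,1]$ is Lipschitz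 continuous with Lipschitz constant $L_\theta$ and monotonically increasing, with $\theta_m\ge0$ a lower bound for $\theta'$. The permeability tensor $K:[0,1]\to\mathbb{R}^{d\times d}$ (symmetric) satisfies, for constants $\kappa_M>\kappa_m\ge0$, $\kappa_m|\mathbf{y}|^2\le\mathbf{y}^{\rm T}K\mathbf{y}\le\kappa_M|\mathbf{y}|^2$ for all $\mathbf{y}\in\mathbb{R}^d$, and $K\circ\theta$ is Lipschitz continuous with constant $L_\kappa$. The inverse square root $K(\theta(\psi_h^{n,i}))^{-1/2}$ is understood to exist a.e. in $\Omega$. $\theta'$ and $(K\circ\theta)'$ denote the derivatives of these Lipschitz functions (fixed bounded Borel representatives, $\theta_m\le\theta'\le L_\theta$). The source is $f\in C(0,T;L^2(\Omega))$ and $f^n:=f(t_n)\in L^2(\Omega)$ where $t_n=n\tau$ is the current time step. *)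

theory Defs
  imports "HOL-Analysis.Analysis"
begin

text \<open>Norms are extended nonnegative: they are infinite, not a default value, for functions
  that are not square integrable.\<close>

definition esqrt :: "ennreal \<Rightarrow> ennreal" where
  "esqrt x = (if x = top then top else ennreal (sqrt (enn2real x)))"

definition L2_norm :: "(real^'d) set \<Rightarrow> (real^'d \<Rightarrow> 'b::euclidean_space) \<Rightarrow> ennreal" where
  "L2_norm S u = esqrt (\<integral>\<^sup>+ x. ennreal ((norm (u x))\<^sup>2) \<partial>lebesgue_on S)"

definition L2 :: "(real^'d) set \<Rightarrow> (real^'d \<Rightarrow> 'b::euclidean_space) set" where
  "L2 S = {u. u \<in> borel_measurable (lebesgue_on S) \<and>
              integrable (lebesgue_on S) (\<lambda>x. (norm (u x))\<^sup>2)}"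

definition L2_inner ::
    "(real^'d) set \<Rightarrow> (real^'d \<Rightarrow> 'b::euclidean_space) \<Rightarrow> (real^'d \<Rightarrow> 'b) \<Rightarrow> real" where
  "L2_inner S u v = (LINT x|lebesgue_on S. u x \<bullet> v x)"

definition C_time_L2 :: "real \<Rightarrow> (real^'d) set \<Rightarrow> (real \<Rightarrow> real^'d \<Rightarrow> real) set" where
  "C_time_L2 T \<Omega> = {f. \<forall>t\<in>{0..T}. f t \<in> L2 \<Omega> \<and>
     ((\<lambda>s. L2_norm \<Omega> (\<lambda>x. f s x - f t x)) \<longlongrightarrow> 0) (at t within {0..T})}"

definition partial :: "'d::finite \<Rightarrow> (real^'d \<Rightarrow> real) \<Rightarrow> real^'d \<Rightarrow> real" where
  "partial k \<phi> x = frechet_derivative \<phi> (at x) (axis k 1)"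

definition classical_grad :: "(real^'d \<Rightarrow> real) \<Rightarrow> real^'d \<Rightarrow> real^'d" where
  "classical_grad \<phi> x = (\<chi> k. partial k \<phi> x)"

primrec Ck :: "nat \<Rightarrow> (real^'d \<Rightarrow> real) \<Rightarrow> bool" where
  "Ck 0 \<phi> = continuous_on UNIV \<phi>"
| "Ck (Suc m) \<phi> = ((\<forall>x. \<phi> differentiable (at x)) \<and> (\<forall>k. Ck m (partial k \<phi>)))"

definition test_functions :: "(real^'d) set \<Rightarrow> (real^'d \<Rightarrow> real) set" where
  "test_functions \<Omega> =
     {\<phi>. (\<forall>m. Ck m \<phi>) \<and> compact (closure {x. \<phi> x \<noteq> 0}) \<and> closure {x. \<phi> x \<noteq> 0} \<subseteq> \<Omega>}"

definition has_weak_grad ::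
    "(real^'d) set \<Rightarrow> (real^'d \<Rightarrow> real) \<Rightarrow> (real^'d \<Rightarrow> real^'d) \<Rightarrow> bool" where
  "has_weak_grad \<Omega> u g \<longleftrightarrow> g \<in> L2 \<Omega> \<and>
     (\<forall>\<phi>\<in>test_functions \<Omega>.
        (LINT x|lebesgue_on \<Omega>. u x *\<^sub>R classical_grad \<phi> x) = - (LINT x|lebesgue_on \<Omega>. \<phi> x *\<^sub>R g x))"

definition H1 :: "(real^'d) set \<Rightarrow> (real^'d \<Rightarrow> real) set" where
  "H1 \<Omega> = {u \<in> L2 \<Omega>. \<exists>g. has_weak_grad \<Omega> u g}"

text \<open>For elements of \<^term>\<open>H1 \<Omega>\<close> the weak gradient is unique up to null sets;
  \<open>grad\<close> picks a representative.\<close>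

definition grad :: "(real^'d) set \<Rightarrow> (real^'d \<Rightarrow> real) \<Rightarrow> real^'d \<Rightarrow> real^'d" where
  "grad \<Omega> u = (SOME g. has_weak_grad \<Omega> u g)"

text \<open>The closure of the test functions in the norm of \<^term>\<open>H1 \<Omega>\<close>.\<close>

definition H10 :: "(real^'d) set \<Rightarrow> (real^'d \<Rightarrow> real) set" where
  "H10 \<Omega> = {u \<in> H1 \<Omega>. \<forall>e>0. \<exists>\<phi>\<in>test_functions \<Omega>.
       L2_norm \<Omega> (\<lambda>x. u x - \<phi> x) < ennreal e \<and>
       L2_norm \<Omega> (\<lambda>x. grad \<Omega> u x - classical_grad \<phi> x) < ennreal e}"

definition has_weak_div ::
    "(real^'d) set \<Rightarrow> (real^'d \<Rightarrow> real^'d) \<Rightarrow> (real^'d \<Rightarrow> real) \<Rightarrow> bool" where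
  "has_weak_div \<Omega> \<sigma> g \<longleftrightarrow> g \<in> L2 \<Omega> \<and>
     (\<forall>\<phi>\<in>test_functions \<Omega>. L2_inner \<Omega> \<sigma> (classical_grad \<phi>) = - L2_inner \<Omega> g \<phi>)"

definition Hdiv :: "(real^'d) set \<Rightarrow> (real^'d \<Rightarrow> real^'d) set" where
  "Hdiv \<Omega> = {\<sigma> \<in> L2 \<Omega>. \<exists>g. has_weak_div \<Omega> \<sigma> g}"

text \<open>Locally, after choosing a unit direction \<open>e\<close>, the set is the strict epigraph (in direction
  \<open>e\<close>) of a Lipschitz function of the component orthogonal to \<open>e\<close>. Extending that function from
  the hyperplane to the whole space is no restriction: compose it with the projection.\<close>

definition lipschitz_boundary :: "(real^'d) set \<Rightarrow> bool" where
  "lipschitz_boundary \<Omega> \<longleftrightarrow> (\<forall>x\<in>frontier \<Omega>. \<exists>r>0. \<exists>e. \<exists>\<gamma>::real^'d \<Rightarrow> real. \<exists>C.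
     norm e = 1 \<and> C-lipschitz_on UNIV \<gamma> \<and>
     (\<forall>y\<in>ball x r. y \<in> \<Omega> \<longleftrightarrow> \<gamma> (y - (e \<bullet> y) *\<^sub>R e) < e \<bullet> y))"

definition polytopal_lipschitz_domain :: "(real^'d) set \<Rightarrow> bool" where
  "polytopal_lipschitz_domain \<Omega> \<longleftrightarrow>
     \<Omega> \<noteq> {} \<and> open \<Omega> \<and> connected \<Omega> \<and> bounded \<Omega> \<and>
     (\<exists>\<P>. finite \<P> \<and> (\<forall>P\<in>\<P>. polytope P) \<and> closure \<Omega> = \<Union>\<P>) \<and>
     lipschitz_boundary \<Omega>"

definition mesh_of :: "(real^'d) set \<Rightarrow> (real^'d) set set \<Rightarrow> bool" where
  "mesh_of \<Omega> \<T> \<longleftrightarrow>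
     triangulation \<T> \<and> (\<forall>E\<in>\<T>. (int CARD('d)) simplex E) \<and> \<Union>\<T> = closure \<Omega>"

definition multi_indices :: "nat \<Rightarrow> ('d::finite \<Rightarrow> nat) set" where
  "multi_indices p = {a. (\<Sum>k\<in>UNIV. a k) \<le> p}"

text \<open>Total degree at most \<open>p\<close>. The index set of the sum is finite, see below.\<close>

definition polys :: "nat \<Rightarrow> (real^'d \<Rightarrow> real) set" where
  "polys p = {q. \<exists>c. \<forall>x. q x = (\<Sum>a\<in>multi_indices p. c a * (\<Prod>k\<in>UNIV. x $ k ^ a k))}"

lemma finite_multi_indices: "finite (multi_indices p :: ('d::finite \<Rightarrow> nat) set)"
proof (rule finite_subset)
  show "(multi_indices p :: ('d \<Rightarrow> nat) set) \<subseteq> (\<Pi>\<^sub>E k\<in>UNIV. {..p})"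
  proof
    fix a :: "'d \<Rightarrow> nat" assume a: "a \<in> multi_indices p"
    have "a k \<le> (\<Sum>k\<in>UNIV. a k)" for k
      by (rule member_le_sum) auto
    with a show "a \<in> (\<Pi>\<^sub>E k\<in>UNIV. {..p})"
      by (auto simp: multi_indices_def intro: order_trans)
  qed
qed (simp add: finite_PiE)

text \<open>Elements are closed and overlap on faces, so discontinuous functions can be prescribed on
  them only up to null sets.\<close>

definition broken_polys :: "nat \<Rightarrow> (real^'d) set set \<Rightarrow> (real^'d \<Rightarrow> real) set" where
  "broken_polys p \<T> = {v. \<forall>E\<in>\<T>. \<exists>q\<in>polys p. AE x in lebesgue_on E. v x = q x}"

definition RT :: "nat \<Rightarrow> (real^'d) set set \<Rightarrow> (real^'d \<Rightarrow> real^'d) set" where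
  "RT p \<T> = {\<sigma>. \<forall>E\<in>\<T>. \<exists>a b. (\<forall>k. (\<lambda>x. a x $ k) \<in> polys p) \<and> b \<in> polys p \<and>
                   (AE x in lebesgue_on E. \<sigma> x = a x + b x *\<^sub>R x)}"

text \<open>Here the continuous representatives are used, so that point values on elements make sense.\<close>

definition Vh :: "(real^'d) set \<Rightarrow> nat \<Rightarrow> (real^'d) set set \<Rightarrow> (real^'d \<Rightarrow> real) set" where
  "Vh \<Omega> p \<T> = {v \<in> H10 \<Omega>. \<forall>E\<in>\<T>. \<exists>q\<in>polys p. \<forall>x\<in>E. v x = q x}"

definition is_L2_projection ::
    "(real^'d) set \<Rightarrow> nat \<Rightarrow> (real^'d) set set \<Rightarrow> ((real^'d \<Rightarrow> real) \<Rightarrow> real^'d \<Rightarrow> real) \<Rightarrow> bool" where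
  "is_L2_projection \<Omega> p \<T> P \<longleftrightarrow>
     (\<forall>u\<in>L2 \<Omega>. P u \<in> broken_polys p \<T> \<and>
        (\<forall>v\<in>broken_polys p \<T>. L2_inner \<Omega> (P u) v = L2_inner \<Omega> u v))"

text \<open>Meaningful for symmetric positive semidefinite \<open>A\<close>, for which such a \<open>B\<close> exists and is unique.\<close>

definition matrix_sqrt :: "real^'d^'d \<Rightarrow> real^'d^'d" where
  "matrix_sqrt A = (SOME B. transpose B = B \<and> (\<forall>y. 0 \<le> y \<bullet> (B *v y)) \<and> B ** B = A)"

definition matrix_inv_sqrt :: "real^'d^'d \<Rightarrow> real^'d^'d" where
  "matrix_inv_sqrt A = matrix_inv (matrix_sqrt A)"

text \<open>In both steps \<open>V\<close> is the discrete space, \<open>z\<close> the height function, \<open>f\<close> the source at the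
  current time, \<open>w\<close> the previous time step, \<open>u\<close> the previous and \<open>u'\<close> the new iterate.\<close>

definition L_scheme_step ::
    "(real^'d) set \<Rightarrow> (real^'d \<Rightarrow> real) set \<Rightarrow> (real \<Rightarrow> real) \<Rightarrow> (real \<Rightarrow> real^'d^'d) \<Rightarrow> (real^'d \<Rightarrow> real) \<Rightarrow>
     real \<Rightarrow> real \<Rightarrow> (real^'d \<Rightarrow> real) \<Rightarrow> (real^'d \<Rightarrow> real) \<Rightarrow> (real^'d \<Rightarrow> real) \<Rightarrow> (real^'d \<Rightarrow> real) \<Rightarrow> bool" where
  "L_scheme_step \<Omega> V \<theta> K z L \<tau> f w u u' \<longleftrightarrow> (\<forall>v\<in>V.
     L * L2_inner \<Omega> (\<lambda>x. u' x - u x) v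
     + \<tau> * L2_inner \<Omega> (\<lambda>x. K (\<theta> (u x)) *v grad \<Omega> (\<lambda>y. u' y + z y) x) (grad \<Omega> v)
     = \<tau> * L2_inner \<Omega> f v - L2_inner \<Omega> (\<lambda>x. \<theta> (u x) - \<theta> (w x)) v)"

text \<open>\<open>\<theta>'\<close> and \<open>K\<theta>'\<close> stand for the derivatives of \<open>\<theta>\<close> and \<open>K \<circ> \<theta>\<close>.\<close>

definition Newton_step ::
    "(real^'d) set \<Rightarrow> (real^'d \<Rightarrow> real) set \<Rightarrow> (real \<Rightarrow> real) \<Rightarrow> (real \<Rightarrow> real) \<Rightarrow>
     (real \<Rightarrow> real^'d^'d) \<Rightarrow> (real \<Rightarrow> real^'d^'d) \<Rightarrow> (real^'d \<Rightarrow> real) \<Rightarrow>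
     real \<Rightarrow> (real^'d \<Rightarrow> real) \<Rightarrow> (real^'d \<Rightarrow> real) \<Rightarrow> (real^'d \<Rightarrow> real) \<Rightarrow> (real^'d \<Rightarrow> real) \<Rightarrow> bool" where
  "Newton_step \<Omega> V \<theta> \<theta>' K K\<theta>' z \<tau> f w u u' \<longleftrightarrow> (\<forall>v\<in>V.
     L2_inner \<Omega> (\<lambda>x. \<theta>' (u x) * (u' x - u x)) v
     + \<tau> * L2_inner \<Omega> (\<lambda>x. K (\<theta> (u x)) *v grad \<Omega> (\<lambda>y. u' y + z y) x) (grad \<Omega> v)
     + \<tau> * L2_inner \<Omega>
         (\<lambda>x. (u' x - u x) *\<^sub>R (K\<theta>' (u x) *v grad \<Omega> (\<lambda>y. u y + z y) x)) (grad \<Omega> v)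
     = \<tau> * L2_inner \<Omega> f v - L2_inner \<Omega> (\<lambda>x. \<theta> (u x) - \<theta> (w x)) v)"

definition newton_norm ::
    "(real^'d) set \<Rightarrow> (real \<Rightarrow> real) \<Rightarrow> (real \<Rightarrow> real) \<Rightarrow> (real \<Rightarrow> real^'d^'d) \<Rightarrow> real \<Rightarrow>
     (real^'d \<Rightarrow> real) \<Rightarrow> (real^'d \<Rightarrow> real) \<Rightarrow> ennreal" where
  "newton_norm \<Omega> \<theta> \<theta>' K \<tau> u v = esqrt (\<integral>\<^sup>+ x. ennreal
     (\<theta>' (u x) * (v x)\<^sup>2 + \<tau> * (norm (matrix_sqrt (K (\<theta> (u x))) *v grad \<Omega> v x))\<^sup>2)
     \<partial>lebesgue_on \<Omega>)"

definition degenerate_elements ::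
    "(real^'d) set set \<Rightarrow> (real \<Rightarrow> real) \<Rightarrow> (real^'d \<Rightarrow> real) \<Rightarrow> real \<Rightarrow> (real^'d) set set" where
  "degenerate_elements \<T> \<theta>' u \<epsilon> = {E\<in>\<T>. (INF x\<in>E. \<theta>' (u x)) < \<epsilon>}"

text \<open>In the estimators \<open>u0\<close> and \<open>u\<close> are consecutive iterates.\<close>

definition L_residual ::
    "(real \<Rightarrow> real) \<Rightarrow> real \<Rightarrow> (real^'d \<Rightarrow> real) \<Rightarrow> (real^'d \<Rightarrow> real) \<Rightarrow> real^'d \<Rightarrow> real" where
  "L_residual \<theta> L u0 u x = L * (u x - u0 x) - (\<theta> (u x) - \<theta> (u0 x))"

definition eta_poten ::
    "(real^'d) set set \<Rightarrow> (real \<Rightarrow> real) \<Rightarrow> (real \<Rightarrow> real) \<Rightarrow> real \<Rightarrow> real \<Rightarrow>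
     (real^'d \<Rightarrow> real) \<Rightarrow> (real^'d \<Rightarrow> real) \<Rightarrow> ennreal" where
  "eta_poten \<T> \<theta> \<theta>' L \<epsilon> u0 u =
     L2_norm (\<Union>(\<T> - degenerate_elements \<T> \<theta>' u \<epsilon>))
       (\<lambda>x. \<theta>' (u x) powr (-1/2) * L_residual \<theta> L u0 u x)"

definition eta_flux ::
    "(real^'d) set \<Rightarrow> (real \<Rightarrow> real) \<Rightarrow> (real \<Rightarrow> real^'d^'d) \<Rightarrow> (real^'d \<Rightarrow> real) \<Rightarrow>
     (real^'d \<Rightarrow> real^'d) \<Rightarrow> (real^'d \<Rightarrow> real) \<Rightarrow> (real^'d \<Rightarrow> real) \<Rightarrow> ennreal" where
  "eta_flux \<Omega> \<theta> K z \<sigma> u0 u =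
     L2_norm \<Omega> (\<lambda>x. matrix_inv_sqrt (K (\<theta> (u x))) *v
       ((K (\<theta> (u x)) - K (\<theta> (u0 x))) *v grad \<Omega> (\<lambda>y. u y + z y) x + \<sigma> x))"

definition eta_L_to_N ::
    "(real^'d) set \<Rightarrow> (real^'d) set set \<Rightarrow> (real \<Rightarrow> real) \<Rightarrow> (real \<Rightarrow> real) \<Rightarrow> (real \<Rightarrow> real^'d^'d) \<Rightarrow>
     (real^'d \<Rightarrow> real) \<Rightarrow> real \<Rightarrow> real \<Rightarrow> real \<Rightarrow> real \<Rightarrow>
     (real^'d \<Rightarrow> real^'d) \<Rightarrow> (real^'d \<Rightarrow> real) \<Rightarrow> (real^'d \<Rightarrow> real) \<Rightarrow> ennreal" where
  "eta_L_to_N \<Omega> \<T> \<theta> \<theta>' K z L \<tau> \<epsilon> C \<sigma> u0 u =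
     ennreal (2 / (2 - C)) *
     esqrt ((eta_poten \<T> \<theta> \<theta>' L \<epsilon> u0 u)\<^sup>2 + ennreal \<tau> * (eta_flux \<Omega> \<theta> K z \<sigma> u0 u)\<^sup>2)"

end

theory Submission
  imports Defs "HOL-Computational_Algebra.Polynomial"
begin

text \<open>
  Write \<open>u\<close> for the last L-scheme iterate, \<open>\<delta>\<close> for the Newton increment and
  \<open>r = L (u - u0) - (\<theta> u - \<theta> u0)\<close>. The Newton step and the L-scheme step, both tested with \<open>\<delta>\<close>,
  have the source and the previous time step in common; subtracting them leaves

    \<open>(\<theta>'(u) \<delta>, \<delta>) + \<tau> (K(\<theta> u) \<nabla>\<delta>, \<nabla>\<delta>)
      = (r, \<delta>) - \<tau> ((K(\<theta> u) - K(\<theta> u0)) \<nabla>(u + z), \<nabla>\<delta>) - \<tau> (\<delta> (K \<circ> \<theta>)'(u) \<nabla>(u + z), \<nabla>\<delta>)\<close>.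

  The left-hand side is the square of the norm to be estimated. On degenerate elements \<open>r\<close> cannot be
  divided by the root of \<open>\<theta>'\<close>, so there it is turned into a flux. The function that equals \<open>\<delta>\<close> on
  these elements and vanishes elsewhere is piecewise polynomial, up to the null set of element faces
  (\<open>Vh_cutoff_broken_poly\<close>); hence \<open>r\<close> may be replaced by its projection, which is \<open>\<tau>\<close> times the
  divergence of \<open>\<sigma>\<close>, and \<open>(\<nabla>\<cdot>\<sigma>, \<delta>) = - (\<sigma>, \<nabla>\<delta>)\<close> by density of the test functions
  (\<open>weak_div_H10\<close>). The remaining part of \<open>(r, \<delta>)\<close> is controlled by the potential estimator, the
  collected fluxes by the flux estimator after splitting \<open>x \<bullet> y = K\<^sup>-\<^sup>1\<^sup>/\<^sup>2 x \<bullet> K\<^sup>1\<^sup>/\<^sup>2 y\<close>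
  (\<open>inner_matrix_sqrt_split\<close>). The last term is at most \<open>C / 2\<close> times the left-hand side by the
  hypothesis on \<open>C\<close> and is absorbed, which produces the factor \<open>2 / (2 - C)\<close>
  (\<open>absorbed_energy_bound\<close>).

  Three foundations carry this argument. Positive semidefinite matrices have symmetric square roots
  (\<open>psd_matrix_has_psd_sqrt\<close>, from a spectral theorem). Weak gradients are unique almost everywhere
  (\<open>weak_grad_unique\<close>, from the fundamental lemma of the calculus of variations with explicit smooth
  bumps); as gradients are arbitrarily chosen representatives, uniqueness is what makes them linear.
  And the height function has its constant slope as weak gradient (\<open>has_weak_grad_linear\<close>).
\<close>

section \<open>Square roots of positive semidefinite matrices\<close>

lemma nonneg_quadratic_imp_linear_coeff_zero:
  fixes a b :: real
  assumes "\<And>t. 0 \<le> 2 * t * a + t\<^sup>2 * b"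
  shows "a = 0"
proof (rule ccontr)
  assume "a \<noteq> 0"
  define c where "c = \<bar>b\<bar> + 1"
  have c: "c > 0" "b < 2 * c" by (auto simp: c_def)
  have "0 \<le> 2 * (- a / c) * a + (- a / c)\<^sup>2 * b" by (rule assms)
  also have "\<dots> = (a\<^sup>2 / c\<^sup>2) * (b - 2 * c)"
    using c by (simp add: field_simps power2_eq_square)
  also have "\<dots> < 0" using c \<open>a \<noteq> 0\<close> by (intro mult_pos_neg) auto
  finally show False by simp
qed

text \<open>A maximiser of the Rayleigh quotient on the unit sphere of an invariant subspace is an
  eigenvector, because the quotient is stationary there; its orthogonal complement in the subspace
  is again invariant and of smaller dimension. The basis is characterised by the expansion formula
  instead of by its span, which is the form in which functions of \<open>f\<close> are built from it.\<close>

lemma selfadjoint_orthonormal_eigenbasis: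
  fixes f :: "'a::euclidean_space \<Rightarrow> 'a"
  assumes lin: "linear f" and sa: "\<And>x y. f x \<bullet> y = x \<bullet> f y"
    and "subspace S" "f ` S \<subseteq> S"
  shows "\<exists>B l. finite B \<and> (\<forall>b\<in>B. f b = l b *\<^sub>R b) \<and> B \<subseteq> S \<and>
           (\<forall>b\<in>B. \<forall>c\<in>B. b \<bullet> c = (if b = c then 1 else 0)) \<and>
           (\<forall>x\<in>S. x = (\<Sum>b\<in>B. (x \<bullet> b) *\<^sub>R b))"
  using assms(3,4)
proof (induction "dim S" arbitrary: S rule: less_induct)
  case less
  show ?case
  proof (cases "S \<subseteq> {0}")
    case True
    then show ?thesis by (intro exI[of _ "{}"]) auto
  next
    case False
    then obtain y where y: "y \<in> S" "y \<noteq> 0" by auto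
    have "y /\<^sub>R norm y \<in> sphere 0 1 \<inter> S"
      using y less.prems(1) by (simp add: subspace_scale)
    then have ne: "sphere 0 1 \<inter> S \<noteq> {}" by blast
    have "compact (sphere 0 1 \<inter> S)"
      by (intro compact_Int_closed compact_sphere closed_subspace less.prems(1))
    moreover have "continuous_on (sphere 0 1 \<inter> S) (\<lambda>x. x \<bullet> f x)"
      by (intro continuous_intros linear_continuous_on_compose[OF continuous_on_id lin])
    ultimately obtain v where v: "v \<in> S" "norm v = 1"
      and vmax: "\<And>w. w \<in> S \<Longrightarrow> norm w = 1 \<Longrightarrow> w \<bullet> f w \<le> v \<bullet> f v"
      using continuous_attains_sup[OF _ ne, of "\<lambda>x. x \<bullet> f x"] by auto
    define \<mu> where "\<mu> = v \<bullet> f v"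
    have vv: "v \<bullet> v = 1" using v by (simp add: norm_eq_1)
    have fS: "f x \<in> S" if "x \<in> S" for x using less.prems(2) that by auto
    have nonneg: "0 \<le> \<mu> * (w \<bullet> w) - w \<bullet> f w" if "w \<in> S" for w
    proof (cases "w = 0")
      case True then show ?thesis by (simp add: linear_0[OF lin])
    next
      case False
      have "(w /\<^sub>R norm w) \<bullet> f (w /\<^sub>R norm w) \<le> \<mu>"
        unfolding \<mu>_def using that False less.prems(1) by (intro vmax) (auto simp: subspace_scale)
      also have "(w /\<^sub>R norm w) \<bullet> f (w /\<^sub>R norm w) = (w \<bullet> f w) / (w \<bullet> w)"
        using False by (simp add: linear_cmul[OF lin] dot_square_norm power2_eq_square divide_simps)
      finally show ?thesis using False by (simp add: divide_simps)
    qed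
    \<comment> \<open>First variation at the maximiser: \<open>\<mu> |w|\<^sup>2 - w \<bullet> f w\<close> is nonnegative and vanishes at \<open>v\<close>.\<close>
    have stationary: "(\<mu> *\<^sub>R v - f v) \<bullet> w = 0" if "w \<in> S" for w
    proof (rule nonneg_quadratic_imp_linear_coeff_zero)
      fix t
      have "0 \<le> \<mu> * ((v + t *\<^sub>R w) \<bullet> (v + t *\<^sub>R w)) - (v + t *\<^sub>R w) \<bullet> f (v + t *\<^sub>R w)"
        using that v less.prems(1) by (intro nonneg subspace_add subspace_scale) auto
      also have "\<dots> = 2 * t * ((\<mu> *\<^sub>R v - f v) \<bullet> w) + t\<^sup>2 * (\<mu> * (w \<bullet> w) - w \<bullet> f w)"
      proof -
        have "w \<bullet> f v = f v \<bullet> w" "w \<bullet> v = v \<bullet> w" and "v \<bullet> f w = f v \<bullet> w"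
          by (rule inner_commute)+ (rule sa[symmetric])
        then show ?thesis
          using vv by (simp add: linear_add[OF lin] linear_cmul[OF lin] \<mu>_def[symmetric]
            inner_add_left inner_add_right inner_diff_left power2_eq_square) (simp add: algebra_simps)
      qed
      finally show "0 \<le> 2 * t * ((\<mu> *\<^sub>R v - f v) \<bullet> w) + t\<^sup>2 * (\<mu> * (w \<bullet> w) - w \<bullet> f w)" .
    qed
    have "\<mu> *\<^sub>R v - f v \<in> S"
      using v less.prems fS by (intro subspace_diff subspace_scale) auto
    then have eig: "f v = \<mu> *\<^sub>R v" using stationary by (metis eq_iff_diff_eq_0 inner_eq_zero_iff)
    define S' where "S' = {x\<in>S. v \<bullet> x = 0}"
    have S': "subspace S'" "f ` S' \<subseteq> S'"
      using less.prems(1) fS sa[of v] unfolding S'_def subspace_def eig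
      by (auto simp: inner_right_distrib) (metis eig inner_scaleR_left mult_zero_right)
    have "S' \<subset> S" using v vv unfolding S'_def by force
    then have "dim S' < dim S"
      using S'(1) less.prems(1) by (metis dim_psubset span_eq_iff)
    from less.hyps[OF this S'] obtain B l where "finite B" "B \<subseteq> S'"
      "\<forall>b\<in>B. f b = l b *\<^sub>R b" "\<forall>b\<in>B. \<forall>c\<in>B. b \<bullet> c = (if b = c then 1 else 0)"
      "\<forall>x\<in>S'. x = (\<Sum>b\<in>B. (x \<bullet> b) *\<^sub>R b)"
      by (elim exE conjE)
    note B = this(1,2) this(3-5)[rule_format]
    have vB: "v \<notin> B" "\<And>b. b \<in> B \<Longrightarrow> v \<bullet> b = 0" using B(2) vv by (auto simp: S'_def)
    have "x = (\<Sum>b\<in>insert v B. (x \<bullet> b) *\<^sub>R b)" if "x \<in> S" for x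
    proof -
      have "x - (x \<bullet> v) *\<^sub>R v \<in> S'"
        using that v vv less.prems(1)
        by (auto simp: S'_def inner_diff_right inner_commute intro!: subspace_diff subspace_scale)
      from B(5)[OF this] have "x - (x \<bullet> v) *\<^sub>R v = (\<Sum>b\<in>B. (x \<bullet> b) *\<^sub>R b)"
        using vB by (simp add: inner_diff_left cong: sum.cong)
      then show ?thesis using B(1) vB(1) by (simp add: algebra_simps)
    qed
    moreover have "\<forall>b\<in>insert v B. \<forall>c\<in>insert v B. b \<bullet> c = (if b = c then 1 else 0)"
      using B(4) vB vv by (auto simp: inner_commute)
    moreover have "\<forall>b\<in>insert v B. f b = (if b = v then \<mu> else l b) *\<^sub>R b"
      using B(3) eig vB by auto
    ultimately show ?thesis
      using B(1,2) v(1) unfolding S'_def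
      by (intro exI[of _ "insert v B"] exI[of _ "\<lambda>b. if b = v then \<mu> else l b"]) auto
  qed
qed

text \<open>Take square roots of the eigenvalues. This is what makes \<^const>\<open>matrix_sqrt\<close> a genuine square
  root on positive semidefinite matrices: its defining choice has a witness.\<close>

lemma psd_matrix_has_psd_sqrt:
  fixes A :: "real^'n^'n"
  assumes sym: "transpose A = A" and psd: "\<And>y. 0 \<le> y \<bullet> (A *v y)"
  shows "\<exists>B. transpose B = B \<and> (\<forall>y. 0 \<le> y \<bullet> (B *v y)) \<and> B ** B = A"
proof -
  have "(A *v x) \<bullet> y = x \<bullet> (A *v y)" for x y
    by (metis dot_lmul_matrix sym vector_transpose_matrix)
  then have sa: "\<And>x y. (A *v x) \<bullet> y = x \<bullet> (A *v y)" .
  from selfadjoint_orthonormal_eigenbasis[OF matrix_vector_mul_linear sa subspace_UNIV subset_UNIV]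
  obtain B l where "finite B" "\<forall>b\<in>B. A *v b = l b *\<^sub>R b" "B \<subseteq> UNIV"
      "\<forall>b\<in>B. \<forall>c\<in>B. b \<bullet> c = (if b = c then 1 else 0)"
      "\<forall>x\<in>UNIV. x = (\<Sum>b\<in>B. (x \<bullet> b) *\<^sub>R b)"
    by (elim exE conjE)
  note B = this(1) this(2,4)[rule_format] this(5)[rule_format, OF UNIV_I]
  have l: "0 \<le> l b" if "b \<in> B" for b
    using psd[of b] B(2,3)[OF that] that by simp
  define g where "g x = (\<Sum>b\<in>B. (sqrt (l b) * (x \<bullet> b)) *\<^sub>R b)" for x
  have lin: "linear g"
    unfolding g_def
    by (intro linearI) (simp_all add: inner_left_distrib algebra_simps sum.distrib scaleR_sum_right)
  define G where "G = matrix g"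
  have G: "G *v x = g x" for x unfolding G_def using lin by (simp add: matrix_works)
  have gy: "y \<bullet> g x = (\<Sum>b\<in>B. sqrt (l b) * (x \<bullet> b) * (y \<bullet> b))" for x y
    by (simp add: g_def inner_sum_right)
  have gb: "g x \<bullet> b = sqrt (l b) * (x \<bullet> b)" if b: "b \<in> B" for x b
  proof -
    have "g x \<bullet> b = (\<Sum>c\<in>B. sqrt (l c) * (x \<bullet> c) * (if b = c then 1 else 0))"
      unfolding inner_commute[of "g x"] gy using b by (intro sum.cong) (auto simp: B(3))
    also have "\<dots> = sqrt (l b) * (x \<bullet> b)" using B(1) b by (simp add: if_distrib cong: if_cong)
    finally show ?thesis .
  qed
  have "g (g x) = A *v x" for x
  proof -
    have "g (g x) = (\<Sum>b\<in>B. (sqrt (l b) * (g x \<bullet> b)) *\<^sub>R b)" by (simp add: g_def)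
    also have "\<dots> = (\<Sum>b\<in>B. A *v ((x \<bullet> b) *\<^sub>R b))"
    proof (intro sum.cong refl)
      fix b assume b: "b \<in> B"
      have "sqrt (l b) * (g x \<bullet> b) = (x \<bullet> b) * l b"
        using l[OF b] unfolding gb[OF b] by (simp flip: mult.assoc)
      then show "(sqrt (l b) * (g x \<bullet> b)) *\<^sub>R b = A *v ((x \<bullet> b) *\<^sub>R b)"
        by (simp add: matrix_vector_mult_scaleR B(2)[OF b])
    qed
    also have "\<dots> = A *v (\<Sum>b\<in>B. (x \<bullet> b) *\<^sub>R b)"
      by (simp add: linear_sum[OF matrix_vector_mul_linear])
    also have "\<dots> = A *v x" using B(4)[of x] by simp
    finally show ?thesis .
  qed
  then have "G ** G = A"
    by (simp add: matrix_eq matrix_vector_mul_assoc[symmetric] G)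
  moreover have "transpose G = G"
  proof -
    have "adjoint g = g"
    proof (intro adjoint_unique allI)
      show "g x \<bullet> y = x \<bullet> g y" for x y
        unfolding inner_commute[of "g x"] gy by (simp add: mult_ac)
    qed
    then show ?thesis unfolding G_def by (metis matrix_adjoint lin)
  qed
  moreover have "0 \<le> y \<bullet> (G *v y)" for y
    unfolding G gy using l by (intro sum_nonneg) (simp add: mult.assoc)
  ultimately show ?thesis by blast
qed

lemma matrix_sqrt_props:
  fixes A :: "real^'n^'n"
  assumes "transpose A = A" "\<And>y. 0 \<le> y \<bullet> (A *v y)"
  shows "transpose (matrix_sqrt A) = matrix_sqrt A" "matrix_sqrt A ** matrix_sqrt A = A"
  using someI_ex[OF psd_matrix_has_psd_sqrt[OF assms]] unfolding matrix_sqrt_def by auto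

lemma inner_symmetric_matrix:
  fixes B :: "real^'n^'n"
  assumes "transpose B = B"
  shows "(B *v x) \<bullet> y = x \<bullet> (B *v y)"
  by (metis dot_lmul_matrix assms vector_transpose_matrix)

lemma norm_matrix_sqrt:
  fixes A :: "real^'n^'n"
  assumes "transpose A = A" "\<And>y. 0 \<le> y \<bullet> (A *v y)"
  shows "(norm (matrix_sqrt A *v y))\<^sup>2 = y \<bullet> (A *v y)"
  using inner_symmetric_matrix[OF matrix_sqrt_props(1)[OF assms], of y "matrix_sqrt A *v y"]
  by (simp add: power2_norm_eq_inner matrix_vector_mul_assoc matrix_sqrt_props(2)[OF assms])

text \<open>A bound on the quadratic form of a symmetric matrix gives one on the operator norm:
  apply the bound twice, to \<open>y\<close> and to \<open>A\<^sup>1\<^sup>/\<^sup>2 y\<close>.\<close>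

lemma psd_matrix_norm_bound:
  fixes A :: "real^'n^'n"
  assumes "transpose A = A" "\<And>y. 0 \<le> y \<bullet> (A *v y)" "\<And>y. y \<bullet> (A *v y) \<le> M * (norm y)\<^sup>2"
    and "0 \<le> M"
  shows "norm (A *v y) \<le> M * norm y"
proof -
  let ?B = "matrix_sqrt A"
  have "(norm (A *v y))\<^sup>2 = (norm (?B *v (?B *v y)))\<^sup>2"
    by (simp add: matrix_vector_mul_assoc matrix_sqrt_props(2)[OF assms(1,2)])
  also have "\<dots> \<le> M * (norm (?B *v y))\<^sup>2"
    unfolding norm_matrix_sqrt[OF assms(1,2), of "?B *v y"] by (rule assms(3))
  also have "\<dots> \<le> M * (M * (norm y)\<^sup>2)"
    unfolding norm_matrix_sqrt[OF assms(1,2), of y] by (intro mult_left_mono assms)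
  also have "\<dots> = (M * norm y)\<^sup>2" by (simp add: power2_eq_square)
  finally show ?thesis by (rule power2_le_imp_le) (use \<open>0 \<le> M\<close> in simp)
qed

text \<open>The weighted Cauchy-Schwarz inequality rests on this splitting of the inner product.\<close>

lemma inner_matrix_sqrt_split:
  fixes A :: "real^'n^'n"
  assumes "transpose A = A" "\<And>y. 0 \<le> y \<bullet> (A *v y)" "invertible (matrix_sqrt A)"
  shows "x \<bullet> y = (matrix_inv_sqrt A *v x) \<bullet> (matrix_sqrt A *v y)"
proof -
  have "(matrix_inv_sqrt A *v x) \<bullet> (matrix_sqrt A *v y) =
      (matrix_sqrt A *v (matrix_inv_sqrt A *v x)) \<bullet> y"
    using inner_symmetric_matrix[OF matrix_sqrt_props(1)[OF assms(1,2)]] by metis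
  also have "\<dots> = x \<bullet> y"
  proof -
    have "matrix_sqrt A ** matrix_inv (matrix_sqrt A) = mat 1"
      using someI_ex[OF assms(3)[unfolded invertible_def]] by (simp add: matrix_inv_def)
    then show ?thesis by (simp add: matrix_vector_mul_assoc matrix_inv_sqrt_def)
  qed
  finally show ?thesis by simp
qed

section \<open>Smooth bump functions\<close>

lemma partial_eq:
  assumes "(\<phi> has_derivative D) (at x)"
  shows "partial k \<phi> x = D (axis k 1)"
  using frechet_derivative_at[OF assms] by (simp add: partial_def)

lemma partial_has_derivative:
  assumes "\<phi> differentiable (at x)"
  shows "(\<phi> has_derivative frechet_derivative \<phi> (at x)) (at x)"
  using assms by (simp add: frechet_derivative_works)

lemma partial_add:
  assumes "\<phi> differentiable (at x)" "\<psi> differentiable (at x)"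
  shows "partial k (\<lambda>x. \<phi> x + \<psi> x) x = partial k \<phi> x + partial k \<psi> x"
  using partial_eq[OF has_derivative_add[OF assms[THEN partial_has_derivative]]]
  by (simp add: partial_def)

lemma partial_mult:
  assumes "\<phi> differentiable (at x)" "\<psi> differentiable (at x)"
  shows "partial k (\<lambda>x. \<phi> x * \<psi> x) x = \<phi> x * partial k \<psi> x + partial k \<phi> x * \<psi> x"
  using partial_eq[OF has_derivative_mult[OF assms[THEN partial_has_derivative]]]
  by (simp add: partial_def)

lemma partial_const: "partial k (\<lambda>x. c) = (\<lambda>x. 0)"
  by (rule ext, subst partial_eq[OF has_derivative_const]) simp

lemma Ck_const: "Ck m (\<lambda>x. c)"
  by (induction m arbitrary: c) (auto simp: partial_const)

lemma Ck_SucD: "Ck (Suc m) \<phi> \<Longrightarrow> Ck m \<phi>"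
proof (induction m arbitrary: \<phi>)
  case 0
  then show ?case
    by (auto simp: continuous_on_eq_continuous_at intro!: differentiable_imp_continuous_within)
qed simp

lemma Ck_add: "Ck m \<phi> \<Longrightarrow> Ck m \<psi> \<Longrightarrow> Ck m (\<lambda>x. \<phi> x + \<psi> x)"
proof (induction m arbitrary: \<phi> \<psi>)
  case 0 then show ?case by (simp add: continuous_on_add)
next
  case (Suc m)
  moreover from Suc.prems have "partial k (\<lambda>x. \<phi> x + \<psi> x) = (\<lambda>x. partial k \<phi> x + partial k \<psi> x)" for k
    by (simp add: partial_add fun_eq_iff)
  ultimately show ?case by simp
qed

lemma Ck_mult: "Ck m \<phi> \<Longrightarrow> Ck m \<psi> \<Longrightarrow> Ck m (\<lambda>x. \<phi> x * \<psi> x)"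
proof (induction m arbitrary: \<phi> \<psi>)
  case 0 then show ?case by (simp add: continuous_on_mult)
next
  case (Suc m)
  moreover from Suc.prems have "partial k (\<lambda>x. \<phi> x * \<psi> x) =
      (\<lambda>x. \<phi> x * partial k \<psi> x + partial k \<phi> x * \<psi> x)" for k
    by (simp add: partial_mult fun_eq_iff)
  moreover have "Ck m \<phi>" "Ck m \<psi>" using Suc.prems by (auto intro: Ck_SucD)
  ultimately show ?case by (simp add: Ck_add)
qed

lemma Ck_prod: "finite I \<Longrightarrow> (\<And>i. i \<in> I \<Longrightarrow> Ck m (\<phi> i)) \<Longrightarrow> Ck m (\<lambda>x. \<Prod>i\<in>I. \<phi> i x)"
  by (induction I rule: finite_induct) (auto simp: Ck_const intro: Ck_mult)

lemma compact_closure_subset: "compact T \<Longrightarrow> closure S \<subseteq> T \<Longrightarrow> compact (closure S)"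
  for S :: "'a::t2_space set"
  using compact_Int_closed[OF _ closed_closure[of S], of T] by (simp add: Int_absorb1)

lemma test_functions_diff:
  assumes "\<phi> \<in> test_functions \<Omega>" "\<psi> \<in> test_functions \<Omega>"
  shows "(\<lambda>x. \<phi> x - \<psi> x) \<in> test_functions \<Omega>"
proof -
  let ?S = "\<lambda>\<phi>. closure {x. \<phi> x \<noteq> (0::real)}"
  have sub: "?S (\<lambda>x. \<phi> x - \<psi> x) \<subseteq> ?S \<phi> \<union> ?S \<psi>"
    unfolding closure_Un[symmetric] by (rule closure_mono) auto
  have "compact (?S \<phi> \<union> ?S \<psi>)" using assms by (auto simp: test_functions_def)
  then have "compact (?S (\<lambda>x. \<phi> x - \<psi> x))"
    using sub by (rule compact_closure_subset)
  moreover have "Ck m (\<lambda>x. \<phi> x - \<psi> x)" for m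
    using Ck_add[of m \<phi> "\<lambda>x. (-1) * \<psi> x"] Ck_mult[of m "\<lambda>x. -1" \<psi>] assms Ck_const
    by (auto simp: test_functions_def)
  ultimately show ?thesis using sub assms by (auto simp: test_functions_def)
qed

lemma classical_grad_diff:
  assumes "\<phi> \<in> test_functions \<Omega>" "\<psi> \<in> test_functions \<Omega>"
  shows "classical_grad (\<lambda>x. \<phi> x - \<psi> x) x = classical_grad \<phi> x - classical_grad \<psi> x"
proof -
  have d: "\<phi> differentiable (at x)" "\<psi> differentiable (at x)"
    using assms by (auto simp: test_functions_def dest!: spec[of _ "Suc 0"])
  show ?thesis
    using partial_eq[OF has_derivative_diff[OF d[THEN partial_has_derivative]]]
    by (simp add: classical_grad_def vec_eq_iff partial_def)
qed

lemma test_function_continuous: "\<phi> \<in> test_functions \<Omega> \<Longrightarrow> continuous_on UNIV \<phi>"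
  by (auto simp: test_functions_def dest: spec[of _ 0])

lemma test_function_partial_continuous: "\<phi> \<in> test_functions \<Omega> \<Longrightarrow> continuous_on UNIV (partial k \<phi>)"
  by (auto simp: test_functions_def dest: spec[of _ "Suc 0"])

lemma classical_grad_continuous: "\<phi> \<in> test_functions \<Omega> \<Longrightarrow> continuous_on UNIV (classical_grad \<phi>)"
  unfolding classical_grad_def
  by (intro continuous_on_vec_lambda test_function_partial_continuous)

lemma partial_eq_0_outside_support:
  assumes "x \<notin> closure {x. \<phi> x \<noteq> 0}"
  shows "partial k \<phi> x = 0"
proof -
  have "(\<phi> has_derivative (\<lambda>v. 0)) (at x)"
  proof (rule has_derivative_transform_within_open[OF has_derivative_const])
    show "open (- closure {x. \<phi> x \<noteq> 0})" by (rule open_Compl) simp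
    show "0 = \<phi> y" if "y \<in> - closure {x. \<phi> x \<noteq> 0}" for y
      using that closure_subset[of "{x. \<phi> x \<noteq> 0}"] by auto
  qed (use assms in auto)
  then show ?thesis by (simp add: partial_eq)
qed

lemma bounded_range_compact_support:
  fixes F :: "'a::euclidean_space \<Rightarrow> 'b::real_normed_vector"
  assumes "continuous_on UNIV F" "compact S" "\<And>x. x \<notin> S \<Longrightarrow> F x = 0"
  shows "\<exists>M. \<forall>x. norm (F x) \<le> M"
proof -
  have "bounded (F ` S)"
    by (intro compact_imp_bounded compact_continuous_image continuous_on_subset[OF assms(1)] assms) auto
  then obtain M where "\<And>x. x \<in> S \<Longrightarrow> norm (F x) \<le> M" by (auto simp: bounded_iff)
  then have "norm (F x) \<le> max 0 M" for x using assms(3)[of x] by (cases "x \<in> S") (auto simp: le_max_iff_disj)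
  then show ?thesis by blast
qed

text \<open>For \<open>p = 1\<close> this is the classical smooth function \<open>exp (- 1 / t)\<close>, flat at the origin. The
  polynomial factor makes the family closed under differentiation, so that smoothness is an
  induction over one formula.\<close>

definition flat_exp :: "real poly \<Rightarrow> real \<Rightarrow> real" where
  "flat_exp p t = (if t > 0 then poly p (1 / t) * exp (- (1 / t)) else 0)"

lemma poly_times_exp_neg_tendsto_0: "((\<lambda>s::real. poly p s * exp (- s)) \<longlongrightarrow> 0) at_top"
proof -
  have "((\<lambda>s. \<Sum>i\<le>degree p. coeff p i * (s ^ i / exp s)) \<longlongrightarrow> (\<Sum>i\<le>degree p. coeff p i * 0)) at_top"
    by (intro tendsto_intros tendsto_power_div_exp_0)
  then show ?thesis
    by (simp add: poly_altdef sum_distrib_right exp_minus divide_inverse mult.assoc)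
qed

lemma flat_exp_tendsto_0: "(flat_exp p \<longlongrightarrow> 0) (at 0)"
proof (rule filterlim_split_at_real)
  show "(flat_exp p \<longlongrightarrow> 0) (at_left 0)"
    by (rule tendsto_eventually) (auto simp: flat_exp_def eventually_at_filter)
  have "((\<lambda>t. poly p (inverse t) * exp (- inverse t)) \<longlongrightarrow> 0) (at_right 0)"
    by (rule filterlim_compose[OF poly_times_exp_neg_tendsto_0 filterlim_inverse_at_top_right])
  then show "(flat_exp p \<longlongrightarrow> 0) (at_right 0)"
    by (rule Lim_transform_eventually) (auto simp: flat_exp_def eventually_at_filter divide_inverse)
qed

lemma flat_exp_has_derivative:
  "(flat_exp p has_real_derivative flat_exp ([:0, 0, 1:] * (p - pderiv p)) t) (at t)"
proof (cases t "0::real" rule: linorder_cases)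
  case less
  then have "(flat_exp p has_real_derivative 0) (at t)"
    by (intro has_field_derivative_transform_within_open[OF DERIV_const open_lessThan[of 0]])
      (auto simp: flat_exp_def)
  moreover have "flat_exp q t = 0" for q using less by (simp add: flat_exp_def)
  ultimately show ?thesis by simp
next
  case greater
  have "((\<lambda>t. poly p (1 / t) * exp (- (1 / t))) has_real_derivative
      flat_exp ([:0, 0, 1:] * (p - pderiv p)) t) (at t)"
    using greater by (auto intro!: derivative_eq_intros poly_DERIV[THEN DERIV_chain2]
      simp: flat_exp_def field_simps power2_eq_square)
  then show ?thesis
    by (rule has_field_derivative_transform_within_open[OF _ open_greaterThan[of 0]])
      (use greater in \<open>auto simp: flat_exp_def\<close>)
next
  case equal
  have "((\<lambda>h. (flat_exp p (0 + h) - flat_exp p 0) / h) \<longlongrightarrow> 0) (at 0)"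
    by (rule Lim_transform_eventually[OF flat_exp_tendsto_0[of "pCons 0 p"]])
      (auto simp: flat_exp_def eventually_at_filter)
  then show ?thesis using equal by (simp add: DERIV_def flat_exp_def)
qed

lemma Ck_flat_exp_affine: "Ck m (\<lambda>x::real^'d. flat_exp p (\<alpha> * x $ k + \<beta>))"
proof (induction m arbitrary: p)
  case 0
  have "continuous_on UNIV (flat_exp p)"
    by (auto simp: continuous_on_eq_continuous_at intro!: DERIV_isCont flat_exp_has_derivative)
  moreover have "continuous_on UNIV (\<lambda>x::real^'d. \<alpha> * x $ k + \<beta>)"
    by (intro continuous_intros)
  ultimately show ?case using continuous_on_compose2[of UNIV "flat_exp p"] by simp
next
  case (Suc m)
  let ?q = "[:0, 0, 1:] * (p - pderiv p)"
  have D: "((\<lambda>x. flat_exp p (\<alpha> * x $ k + \<beta>)) has_derivative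
      (\<lambda>v. flat_exp ?q (\<alpha> * x $ k + \<beta>) * (\<alpha> * v $ k))) (at x)" for x :: "real^'d"
    by (rule has_derivative_compose[OF _ flat_exp_has_derivative[unfolded has_field_derivative_def],
          of "\<lambda>x. \<alpha> * x $ k + \<beta>" "\<lambda>v. \<alpha> * v $ k"])
      (auto intro!: derivative_eq_intros bounded_linear_imp_has_derivative bounded_linear_vec_nth)
  have "partial j (\<lambda>x::real^'d. flat_exp p (\<alpha> * x $ k + \<beta>)) =
      (\<lambda>x. (if j = k then \<alpha> else 0) * flat_exp ?q (\<alpha> * x $ k + \<beta>))" for j
    by (rule ext, subst partial_eq[OF D]) (auto simp: axis_def)
  then show ?case
    using Suc.IH[of ?q] D Ck_const by (auto simp: differentiable_def intro!: Ck_mult simp del: mult_pCons_left)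
qed

text \<open>No normalisation or smooth step is needed to approximate the indicator of a box: rescaling the
  argument of \<open>exp (- 1 / t)\<close> by \<open>n\<close> takes its \<open>n\<close>-th root, which tends to \<open>1\<close> on the positive
  half line. The index is shifted by one to keep the scaling factor positive.\<close>

definition box_bump :: "nat \<Rightarrow> real^'d \<Rightarrow> real^'d \<Rightarrow> real^'d \<Rightarrow> real" where
  "box_bump n a b x = (\<Prod>k\<in>UNIV. flat_exp 1 (real (Suc n) * (x $ k - a $ k)) *
                               flat_exp 1 (real (Suc n) * (b $ k - x $ k)))"

lemma Ck_box_bump: "Ck m (box_bump n a (b :: real^'d))"
proof -
  have "Ck m (\<lambda>x::real^'d. flat_exp 1 (real (Suc n) * (x $ k - a $ k)) *
                    flat_exp 1 (real (Suc n) * (b $ k - x $ k)))" for k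
    using Ck_mult[OF Ck_flat_exp_affine[of m 1 "real (Suc n)" k "- real (Suc n) * a $ k"]
      Ck_flat_exp_affine[of m 1 "- real (Suc n)" k "real (Suc n) * b $ k"]]
    by (simp add: algebra_simps)
  then show ?thesis unfolding box_bump_def by (intro Ck_prod) auto
qed

lemma flat_exp_1_bounds: "0 \<le> flat_exp 1 t" "flat_exp 1 t \<le> 1"
  by (auto simp: flat_exp_def)

lemma box_bump_bounds: "0 \<le> box_bump n a b x" "box_bump n a b x \<le> 1"
  unfolding box_bump_def
  by (auto intro!: prod_nonneg prod_le_1 mult_nonneg_nonneg mult_le_one flat_exp_1_bounds)

lemma box_bump_eq_0:
  assumes "x \<notin> box a b"
  shows "box_bump n a b x = 0"
proof -
  obtain k where "\<not> (a $ k < x $ k \<and> x $ k < b $ k)"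
    using assms unfolding mem_box_cart by blast
  then have "flat_exp 1 (real (Suc n) * (x $ k - a $ k)) * flat_exp 1 (real (Suc n) * (b $ k - x $ k)) = 0"
    by (auto simp: flat_exp_def zero_less_mult_iff)
  then show ?thesis unfolding box_bump_def by (intro prod_zero) auto
qed

lemma box_bump_tendsto_indicator:
  "(\<lambda>n. box_bump n a b (x :: real^'d)) \<longlonglongrightarrow> indicator (box a b) x"
proof (cases "x \<in> box a b")
  case True
  have *: "(\<lambda>n. flat_exp 1 (real (Suc n) * t)) \<longlonglongrightarrow> 1" if "t > 0" for t
  proof -
    have "(\<lambda>n. exp (- (inverse (real (Suc n)) / t))) \<longlonglongrightarrow> exp (- (0 / t))"
      using that by (intro tendsto_intros LIMSEQ_inverse_real_of_nat) auto
    moreover have "flat_exp 1 (real (Suc n) * t) = exp (- (inverse (real (Suc n)) / t))" for n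
    proof -
      have "0 < real (Suc n) * t" using that by simp
      then show ?thesis by (simp add: flat_exp_def inverse_eq_divide)
    qed
    ultimately show ?thesis by simp
  qed
  have "(\<lambda>n. box_bump n a b x) \<longlonglongrightarrow> (\<Prod>k\<in>(UNIV::'d set). 1 * 1)"
    unfolding box_bump_def using True
    by (intro tendsto_prod tendsto_mult *) (auto simp: mem_box_cart)
  then show ?thesis using True by simp
qed (simp add: box_bump_eq_0)

lemma box_bump_test_function:
  assumes "cbox a b \<subseteq> \<Omega>"
  shows "box_bump n a b \<in> test_functions \<Omega>"
proof -
  have "closure {x. box_bump n a b x \<noteq> 0} \<subseteq> cbox a b"
    using box_bump_eq_0[of _ a b n] box_subset_cbox[of a b] by (intro closure_minimal) auto
  then show ?thesis
    using assms Ck_box_bump compact_closure_subset[OF compact_cbox[of a b]]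
    by (auto simp: test_functions_def)
qed

section \<open>Square integrable functions\<close>

lemma esqrt_power2: "(esqrt x)\<^sup>2 = x"
  by (cases x) (auto simp: esqrt_def ennreal_power)

lemma esqrt_ennreal: "0 \<le> a \<Longrightarrow> esqrt (ennreal a) = ennreal (sqrt a)"
  by (simp add: esqrt_def)

lemma esqrt_mono: "x \<le> y \<Longrightarrow> esqrt x \<le> esqrt y"
  by (auto simp: esqrt_def top_unique less_top[symmetric] intro!: ennreal_leI enn2real_mono)

lemma L2_normD: "(L2_norm S u)\<^sup>2 = (\<integral>\<^sup>+ x. ennreal ((norm (u x))\<^sup>2) \<partial>lebesgue_on S)"
  by (simp add: L2_norm_def esqrt_power2)

lemma L2_measurable: "u \<in> L2 S \<Longrightarrow> u \<in> borel_measurable (lebesgue_on S)"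
  by (simp add: L2_def)

lemma L2_dominated:
  assumes "u \<in> L2 S" "v \<in> borel_measurable (lebesgue_on S)"
    and "AE x in lebesgue_on S. norm (v x) \<le> M * norm (u x)"
  shows "v \<in> L2 S"
proof -
  have "integrable (lebesgue_on S) (\<lambda>x. M\<^sup>2 * (norm (u x))\<^sup>2)"
    using assms(1) by (simp add: L2_def)
  moreover have "AE x in lebesgue_on S. norm ((norm (v x))\<^sup>2) \<le> norm (M\<^sup>2 * (norm (u x))\<^sup>2)"
    using assms(3) by eventually_elim (auto simp: power_mult_distrib[symmetric] intro: power_mono)
  moreover have "(\<lambda>x. (norm (v x))\<^sup>2) \<in> borel_measurable (lebesgue_on S)"
    using assms(2) by measurable
  ultimately have "integrable (lebesgue_on S) (\<lambda>x. (norm (v x))\<^sup>2)"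
    using Bochner_Integration.integrable_bound by blast
  then show ?thesis using assms(2) by (simp add: L2_def)
qed

lemma power2_norm_add_le: "(norm (a + b))\<^sup>2 \<le> 2 * (norm a)\<^sup>2 + 2 * (norm b)\<^sup>2"
proof -
  have "(norm (a + b))\<^sup>2 \<le> (norm a + norm b)\<^sup>2" by (intro power_mono norm_triangle_ineq) auto
  also have "\<dots> \<le> 2 * (norm a)\<^sup>2 + 2 * (norm b)\<^sup>2"
    using zero_le_power2[of "norm a - norm b"] by (simp add: power2_sum power2_diff)
  finally show ?thesis .
qed

lemma L2_add:
  assumes "u \<in> L2 S" "v \<in> L2 S"
  shows "(\<lambda>x. u x + v x) \<in> L2 S"
proof -
  have "integrable (lebesgue_on S) (\<lambda>x. 2 * (norm (u x))\<^sup>2 + 2 * (norm (v x))\<^sup>2)"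
    using assms by (simp add: L2_def)
  then have "integrable (lebesgue_on S) (\<lambda>x. (norm (u x + v x))\<^sup>2)"
    by (rule Bochner_Integration.integrable_bound)
      (use assms in \<open>auto simp: L2_def power2_norm_add_le intro!: AE_I2\<close>)
  then show ?thesis using assms by (auto simp: L2_def)
qed

lemma L2_scaleR:
  assumes "u \<in> L2 S"
  shows "(\<lambda>x. c *\<^sub>R u x) \<in> L2 S"
proof (rule L2_dominated[OF assms])
  show "(\<lambda>x. c *\<^sub>R u x) \<in> borel_measurable (lebesgue_on S)"
    by (intro borel_measurable_scaleR borel_measurable_const L2_measurable assms)
  show "AE x in lebesgue_on S. norm (c *\<^sub>R u x) \<le> \<bar>c\<bar> * norm (u x)" by simp
qed

lemma L2_diff: "u \<in> L2 S \<Longrightarrow> v \<in> L2 S \<Longrightarrow> (\<lambda>x. u x - v x) \<in> L2 S"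
  using L2_add[of u S "\<lambda>x. (-1) *\<^sub>R v x"] L2_scaleR[of v S "-1"] by simp

lemma norm_mult_le_squares: "a * b \<le> a\<^sup>2 + (b::real)\<^sup>2"
  using zero_le_power2[of "a - b"] zero_le_power2[of "a"] zero_le_power2[of "b"]
    unfolding power2_diff by linarith

lemma L2_inner_integrable:
  assumes "u \<in> L2 S" "v \<in> L2 S"
  shows "integrable (lebesgue_on S) (\<lambda>x. u x \<bullet> v x)"
proof (rule Bochner_Integration.integrable_bound)
  show "integrable (lebesgue_on S) (\<lambda>x. (norm (u x))\<^sup>2 + (norm (v x))\<^sup>2)"
    using assms by (simp add: L2_def)
  have "\<bar>u x \<bullet> v x\<bar> \<le> (norm (u x))\<^sup>2 + (norm (v x))\<^sup>2" for x
    using Cauchy_Schwarz_ineq2 norm_mult_le_squares by (rule order_trans)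
  then show "AE x in lebesgue_on S. norm (u x \<bullet> v x) \<le> norm ((norm (u x))\<^sup>2 + (norm (v x))\<^sup>2)"
    by simp
qed (intro borel_measurable_inner L2_measurable assms)

lemma L2_scaleR_integrable:
  fixes u :: "real^'d \<Rightarrow> real"
  assumes "u \<in> L2 S" "v \<in> L2 S"
  shows "integrable (lebesgue_on S) (\<lambda>x. u x *\<^sub>R v x)"
proof (rule Bochner_Integration.integrable_bound)
  show "integrable (lebesgue_on S) (\<lambda>x. (norm (u x))\<^sup>2 + (norm (v x))\<^sup>2)"
    using assms by (simp add: L2_def)
  have "norm (u x *\<^sub>R v x) \<le> (norm (u x))\<^sup>2 + (norm (v x))\<^sup>2" for x
    unfolding norm_scaleR real_norm_def by (rule norm_mult_le_squares)
  then show "AE x in lebesgue_on S. norm (u x *\<^sub>R v x) \<le> norm ((norm (u x))\<^sup>2 + (norm (v x))\<^sup>2)"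
    by simp
qed (intro borel_measurable_scaleR L2_measurable assms)

lemma L2_bounded:
  assumes "S \<in> lmeasurable" "u \<in> borel_measurable (lebesgue_on S)" "\<And>x. x \<in> S \<Longrightarrow> norm (u x) \<le> M"
  shows "u \<in> L2 S"
proof (rule L2_dominated[OF _ assms(2)])
  interpret finite_measure "lebesgue_on S" by (rule finite_measure_lebesgue_on[OF assms(1)])
  show "(\<lambda>x. 1::real) \<in> L2 S" by (simp add: L2_def)
  show "AE x in lebesgue_on S. norm (u x) \<le> M * norm (1::real)"
    using assms(3) by (intro AE_I2) (auto simp: space_restrict_space)
qed

lemma continuous_lebesgue_on_measurable:
  "continuous_on UNIV u \<Longrightarrow> u \<in> borel_measurable (lebesgue_on S)"
  by (intro measurable_restrict_space1 measurable_completion) (simp add: borel_measurable_continuous_onI)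

lemma test_function_L2:
  assumes "S \<in> lmeasurable" "\<phi> \<in> test_functions \<Omega>"
  shows "\<phi> \<in> L2 S"
proof -
  have c: "compact (closure {x. \<phi> x \<noteq> 0})" using assms(2) by (simp add: test_functions_def)
  have "\<phi> x = 0" if "x \<notin> closure {x. \<phi> x \<noteq> 0}" for x
    using that closure_subset[of "{x. \<phi> x \<noteq> 0}"] by auto
  then obtain M where "\<And>x. norm (\<phi> x) \<le> M"
    using bounded_range_compact_support[OF test_function_continuous[OF assms(2)] c] by blast
  then show ?thesis
    by (intro L2_bounded[OF assms(1), of _ M] continuous_lebesgue_on_measurable
        test_function_continuous[OF assms(2)])
qed

lemma classical_grad_L2:
  assumes "S \<in> lmeasurable" "\<phi> \<in> test_functions \<Omega>"
  shows "classical_grad \<phi> \<in> L2 S"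
proof -
  have c: "compact (closure {x. \<phi> x \<noteq> 0})" using assms(2) by (simp add: test_functions_def)
  have "classical_grad \<phi> x = 0" if "x \<notin> closure {x. \<phi> x \<noteq> 0}" for x
    using partial_eq_0_outside_support[OF that] by (simp add: classical_grad_def vec_eq_iff)
  then obtain M where "\<And>x. norm (classical_grad \<phi> x) \<le> M"
    using bounded_range_compact_support[OF classical_grad_continuous[OF assms(2)] c] by blast
  then show ?thesis
    by (intro L2_bounded[OF assms(1), of _ M] continuous_lebesgue_on_measurable
        classical_grad_continuous[OF assms(2)])
qed

section \<open>Weak gradients\<close>

text \<open>Boxes form a generator of the Borel sets that is stable under intersection, so vanishing integrals
  propagate from boxes to all Borel sets. Confining \<open>F\<close> to one box makes the integral over the whole
  space one of the known ones, which the complement step needs.\<close>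

lemma AE_eq_0_of_box_integrals_eq_0:
  fixes F :: "real^'d \<Rightarrow> real"
  assumes F: "integrable lborel F" and Fbox: "\<And>x. x \<notin> box c d \<Longrightarrow> F x = 0"
    and zero: "\<And>a b. cbox a b \<subseteq> cbox c d \<Longrightarrow> (LINT x:box a b|lborel. F x) = 0"
  shows "AE x in lborel. F x = 0"
proof -
  have total: "(LINT x|lborel. F x) = 0"
  proof -
    have "(LINT x|lborel. F x) = (LINT x:box c d|lborel. F x)"
      unfolding set_lebesgue_integral_def
      by (rule Bochner_Integration.integral_cong) (auto simp: Fbox indicator_def)
    then show ?thesis using zero[of c d] by simp
  qed
  have "(LINT x:A|lborel. F x) = 0" if "A \<in> sets borel" for A :: "(real^'d) set"
  proof -
    let ?G = "range (\<lambda>(a, b). box a b :: (real^'d) set)"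
    have "Int_stable ?G" by (auto simp: Int_stable_def box_Int_box)
    moreover have "?G \<subseteq> Pow UNIV" by simp
    moreover have "A \<in> sigma_sets UNIV ?G"
      using that unfolding borel_eq_box by simp
    ultimately show ?thesis
    proof (induction rule: sigma_sets_induct_disjoint)
      fix B assume "B \<in> ?G"
      then obtain a b where B: "B = box a b" by auto
      obtain a' b' where ab': "box a b \<inter> box c d = box a' b'" by (auto simp: box_Int_box)
      have "(LINT x:B|lborel. F x) = (LINT x:box a' b'|lborel. F x)"
        unfolding set_lebesgue_integral_def B ab'[symmetric]
        by (rule Bochner_Integration.integral_cong) (auto simp: Fbox indicator_def)
      also have "\<dots> = 0"
      proof (cases "box a' b' = {}")
        case True then show ?thesis by (simp add: set_lebesgue_integral_def)
      next
        case False
        have "closure (box a' b') \<subseteq> cbox c d"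
          using ab' box_subset_cbox[of c d] by (intro closure_minimal) auto
        then show ?thesis using False by (intro zero) (simp add: closure_box)
      qed
      finally show "(LINT x:B|lborel. F x) = 0" .
    next
      show "(LINT x:{}|lborel. F x) = 0" by (simp add: set_lebesgue_integral_def)
    next
      fix B assume "B \<in> sigma_sets UNIV ?G" and B0: "(LINT x:B|lborel. F x) = 0"
      then have B: "B \<in> sets borel" unfolding borel_eq_box by simp
      have "(LINT x:UNIV - B|lborel. F x) = (LINT x|lborel. F x - indicator B x *\<^sub>R F x)"
        unfolding set_lebesgue_integral_def
        by (rule Bochner_Integration.integral_cong) (auto simp: indicator_def)
      also have "\<dots> = (LINT x|lborel. F x) - (LINT x:B|lborel. F x)"
        unfolding set_lebesgue_integral_def using F B
        by (intro Bochner_Integration.integral_diff integrable_mult_indicator) auto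
      finally show "(LINT x:UNIV - B|lborel. F x) = 0" using total B0 by simp
    next
      fix B :: "nat \<Rightarrow> (real^'d) set"
      assume dis: "disjoint_family B" and "range B \<subseteq> sigma_sets UNIV ?G"
        and B0: "\<And>i. (LINT x:B i|lborel. F x) = 0"
      then have B: "B i \<in> sets borel" for i unfolding borel_eq_box by auto
      have "(LINT x:(\<Union>i. B i)|lborel. F x) = (\<Sum>i. (LINT x:B i|lborel. F x))"
      proof (rule lebesgue_integral_countable_add)
        show "set_integrable lborel (\<Union>i. B i) F"
          unfolding set_integrable_def using B F by (intro integrable_mult_indicator) auto
      qed (use dis B in \<open>auto simp: disjoint_family_on_def\<close>)
      then show "(LINT x:(\<Union>i. B i)|lborel. F x) = 0" by (simp add: B0)
    qed
  qed
  then show ?thesis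
    using density_unique_real[OF F integrable_zero] by (simp add: set_lebesgue_integral_def)
qed

lemma AE_lebesgue_on_iff:
  assumes "S \<in> sets lebesgue"
  shows "(AE x in lebesgue_on S. P x) \<longleftrightarrow> (AE x in lborel. x \<in> S \<longrightarrow> P x)"
  using assms by (simp add: AE_restrict_space_iff AE_completion_iff)

text \<open>The bumps converge boundedly to the indicator of a box, so \<open>g\<close> has vanishing integral over every
  box whose closure lies in \<open>\<Omega>\<close>. The argument runs on a Borel representative of \<open>g\<close>, and closed
  boxes are used to exhaust \<open>\<Omega>\<close> by countably many.\<close>

lemma fundamental_lemma_calculus_of_variations:
  fixes g :: "real^'d \<Rightarrow> real"
  assumes "open \<Omega>" and g: "integrable (lebesgue_on \<Omega>) g"
    and zero: "\<And>\<phi>. \<phi> \<in> test_functions \<Omega> \<Longrightarrow> (LINT x|lebesgue_on \<Omega>. \<phi> x * g x) = 0"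
  shows "AE x in lebesgue_on \<Omega>. g x = 0"
proof -
  have \<Omega>: "\<Omega> \<in> sets lebesgue" using \<open>open \<Omega>\<close> by auto
  let ?G = "\<lambda>x. indicator \<Omega> x * g x"
  have G: "integrable lebesgue ?G"
    using g \<Omega> by (simp add: integrable_restrict_space)
  then obtain G' where G'[measurable]: "G' \<in> borel_measurable lborel" and eq: "AE x in lborel. ?G x = G' x"
    using completion_ex_borel_measurable_real[of ?G lborel] by blast
  have G'_int: "integrable lborel G'"
  proof -
    have "integrable lebesgue G'"
      using G eq by (subst integrable_cong_AE[of _ _ ?G]) (auto simp: AE_completion_iff eq_commute intro: measurable_completion)
    then show ?thesis by (simp add: integrable_completion)
  qed
  have box0: "(LINT x:box a b|lborel. G' x) = 0" if ab: "cbox a b \<subseteq> \<Omega>" for a b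
  proof -
    have [measurable]: "box_bump n a b \<in> borel_measurable borel" for n
      using Ck_box_bump[of 0 n a b] by (simp add: borel_measurable_continuous_onI)
    have "(LINT x|lborel. box_bump n a b x * G' x) = 0" for n
    proof -
      have "(LINT x|lborel. box_bump n a b x * G' x) = (LINT x|lebesgue. box_bump n a b x * G' x)"
        by (rule integral_completion[symmetric]) simp
      also have "\<dots> = (LINT x|lebesgue. box_bump n a b x * ?G x)"
      proof (rule integral_cong_AE)
        show "(\<lambda>x. box_bump n a b x * G' x) \<in> borel_measurable lebesgue"
          by (rule measurable_completion) measurable
        show "(\<lambda>x. box_bump n a b x * ?G x) \<in> borel_measurable lebesgue"
          by (rule borel_measurable_times[OF measurable_completion borel_measurable_integrable[OF G]])
            measurable
        show "AE x in lebesgue. box_bump n a b x * G' x = box_bump n a b x * ?G x"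
          using AE_completion[OF eq] by eventually_elim simp
      qed
      also have "\<dots> = (LINT x|lebesgue_on \<Omega>. box_bump n a b x * g x)"
        using \<Omega> by (simp add: integral_restrict_space mult_ac)
      also have "\<dots> = 0" by (rule zero[OF box_bump_test_function[OF ab]])
      finally show ?thesis .
    qed
    moreover have "(\<lambda>n. LINT x|lborel. box_bump n a b x * G' x) \<longlonglongrightarrow> (LINT x:box a b|lborel. G' x)"
      unfolding set_lebesgue_integral_def
    proof (rule integral_dominated_convergence)
      show "integrable lborel (\<lambda>x. \<bar>G' x\<bar>)" using G'_int by simp
      show "AE x in lborel. norm (box_bump n a b x * G' x) \<le> \<bar>G' x\<bar>" for n
        using mult_right_mono[OF box_bump_bounds(2)[of n a b] abs_ge_zero] box_bump_bounds(1)[of n a b]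
        by (intro AE_I2) (simp add: abs_mult)
      show "AE x in lborel. (\<lambda>n. box_bump n a b x * G' x) \<longlonglongrightarrow> indicator (box a b) x *\<^sub>R G' x"
        using box_bump_tendsto_indicator by (intro AE_I2) (auto intro!: tendsto_mult)
    qed auto
    ultimately show ?thesis by (simp add: LIMSEQ_const_iff)
  qed
  have cbox0: "AE x in lborel. x \<in> cbox a b \<longrightarrow> G' x = 0" if ab: "cbox a b \<subseteq> \<Omega>" for a b
  proof -
    have "AE x in lborel. indicator (box a b) x * G' x = 0"
    proof (rule AE_eq_0_of_box_integrals_eq_0)
      show "integrable lborel (\<lambda>x. indicator (box a b) x * G' x)"
        using integrable_mult_indicator[OF _ G'_int, of "box a b"] by simp
      fix a' b' assume sub: "cbox a' b' \<subseteq> cbox a b"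
      have "box a' b' \<subseteq> box a b"
        using interior_mono[OF sub] by (simp add: interior_cbox)
      then have "(LINT x:box a' b'|lborel. indicator (box a b) x * G' x) = (LINT x:box a' b'|lborel. G' x)"
        unfolding set_lebesgue_integral_def
        by (intro Bochner_Integration.integral_cong) (auto simp: indicator_def)
      also have "\<dots> = 0" using sub ab by (intro box0) auto
      finally show "(LINT x:box a' b'|lborel. indicator (box a b) x * G' x) = 0" .
    qed auto
    moreover have "AE x in lborel. x \<notin> cbox a b - box a b"
    proof -
      have "cbox a b - box a b \<in> null_sets lborel"
        using negligible_frontier_interval[of a b]
        by (simp add: negligible_iff_null_sets null_sets_completion_iff)
      then show ?thesis by (rule AE_not_in)
    qed
    ultimately show ?thesis by eventually_elim (auto simp: indicator_def split: if_splits)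
  qed
  obtain \<D> where \<D>: "countable \<D>" "\<D> \<subseteq> Pow \<Omega>" "\<And>X. X \<in> \<D> \<Longrightarrow> \<exists>a b. X = cbox a b" "\<Union>\<D> = \<Omega>"
    using open_countable_Union_open_cbox[OF \<open>open \<Omega>\<close>] by metis
  have "AE x in lborel. \<forall>X\<in>\<D>. x \<in> X \<longrightarrow> G' x = 0"
    using \<D>(1)
  proof (rule AE_ball_countable[THEN iffD2], intro ballI)
    fix X assume "X \<in> \<D>"
    then show "AE x in lborel. x \<in> X \<longrightarrow> G' x = 0" using \<D>(2,3) cbox0 by blast
  qed
  then have "AE x in lborel. x \<in> \<Omega> \<longrightarrow> g x = 0"
    using eq by eventually_elim (use \<D>(4) in \<open>auto simp: indicator_def split: if_splits\<close>)
  then show ?thesis using \<Omega> by (simp add: AE_lebesgue_on_iff)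
qed

text \<open>By translation invariance all difference quotients of \<open>F\<close> have integral zero; they are bounded
  by a Lipschitz constant and live in a fixed ball, so the limit may be taken under the integral.\<close>

lemma integral_partial_eq_0:
  fixes F :: "real^'d \<Rightarrow> real"
  assumes "Ck (Suc 0) F" and S: "compact (closure {x. F x \<noteq> 0})"
  shows "(LINT x|lborel. partial k F x) = 0"
proof -
  let ?S = "closure {x. F x \<noteq> 0}" and ?v = "axis k 1 :: real^'d"
  have diff: "F differentiable (at x)" for x using assms(1) by simp
  have contF: "continuous_on UNIV F" using Ck_SucD[OF assms(1)] by simp
  have contP: "continuous_on UNIV (partial k F)" using assms(1) by simp
  note [measurable] = borel_measurable_continuous_onI[OF contF] borel_measurable_continuous_onI[OF contP]
  have F0: "F x = 0" if "x \<notin> ?S" for x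
    using that closure_subset[of "{x. F x \<noteq> 0}"] by auto
  obtain M where M: "\<And>x. norm (partial k F x) \<le> M"
    using bounded_range_compact_support[OF contP S partial_eq_0_outside_support] by blast
  have line: "((\<lambda>t. F (x + t *\<^sub>R ?v)) has_real_derivative partial k F (x + t *\<^sub>R ?v)) (at t)" for x t
  proof -
    let ?y = "x + t *\<^sub>R ?v"
    have "((\<lambda>t. F (x + t *\<^sub>R ?v)) has_derivative (\<lambda>h. frechet_derivative F (at ?y) (h *\<^sub>R ?v))) (at t)"
      by (rule has_derivative_compose[OF _ partial_has_derivative[OF diff]])
        (auto intro!: derivative_eq_intros)
    moreover have "frechet_derivative F (at ?y) (h *\<^sub>R ?v) = partial k F ?y * h" for h
      using linear_cmul[OF linear_frechet_derivative[OF diff], of ?y h ?v] by (simp add: partial_def)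
    ultimately show ?thesis by (simp add: has_field_derivative_def)
  qed
  have lip: "\<bar>F (x + t *\<^sub>R ?v) - F x\<bar> \<le> M * t" if t: "0 < t" for x t
  proof -
    obtain s where "F (x + t *\<^sub>R ?v) - F (x + 0 *\<^sub>R ?v) = (t - 0) * partial k F (x + s *\<^sub>R ?v)"
      using MVT2[OF t line] by blast
    then show ?thesis
      using M[of "x + s *\<^sub>R ?v"] t by (auto simp: abs_mult mult.commute intro!: mult_right_mono)
  qed
  obtain R where R: "\<And>x. x \<in> ?S \<Longrightarrow> norm x \<le> R"
    using compact_imp_bounded[OF S] by (auto simp: bounded_iff)
  define h where "h n = inverse (real (Suc n))" for n
  have h: "0 < h n" "h n \<le> 1" for n by (auto simp: h_def field_simps)
  define q where "q n x = (F (x + h n *\<^sub>R ?v) - F x) / h n" for n x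
  have q_meas[measurable]: "q n \<in> borel_measurable lborel" for n unfolding q_def by measurable
  have bound: "\<bar>q n x\<bar> \<le> M * indicator (cball 0 (R + 1)) x" for n x
  proof (cases "x \<in> cball 0 (R + 1)")
    case True
    then show ?thesis using lip[OF h(1)[of n], of x] h(1)[of n] by (simp add: q_def field_simps)
  next
    case False
    have "norm x \<le> norm (x + h n *\<^sub>R ?v) + norm (h n *\<^sub>R ?v)"
      using norm_triangle_ineq4[of "x + h n *\<^sub>R ?v" "h n *\<^sub>R ?v"] by simp
    also have "norm (h n *\<^sub>R ?v) \<le> 1" using h[of n] by simp
    finally have "x + h n *\<^sub>R ?v \<notin> ?S" "x \<notin> ?S"
      using False R[of x] R[of "x + h n *\<^sub>R ?v"] by auto
    from this[THEN F0] show ?thesis using False by (simp add: q_def)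
  qed
  have F_int: "integrable lborel F"
  proof -
    obtain M' where M': "\<And>x. norm (F x) \<le> M'"
      using bounded_range_compact_support[OF contF S F0] by blast
    have "integrable lborel (\<lambda>x. M' * indicator ?S x)"
      using emeasure_compact_finite[OF S]
      by (intro integrable_mult_right integrable_real_indicator) auto
    moreover have "norm (F x) \<le> norm (M' * indicator ?S x)" for x
      using M'[of x] F0[of x] by (cases "x \<in> ?S") auto
    then have "AE x in lborel. norm (F x) \<le> norm (M' * indicator ?S x)" by simp
    ultimately show ?thesis
      by (intro Bochner_Integration.integrable_bound[of _ "\<lambda>x. M' * indicator ?S x" F]) auto
  qed
  have "(LINT x|lborel. q n x) = 0" for n
  proof -
    let ?T = "(+) (h n *\<^sub>R ?v)"
    have "(LINT x|lborel. F (?T x)) = (LINT x|distr lborel borel ?T. F x)"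
      by (rule integral_distr[symmetric]) auto
    then have eq: "(LINT x|lborel. F (x + h n *\<^sub>R ?v)) = (LINT x|lborel. F x)"
      by (simp add: lborel_distr_plus add.commute)
    have "integrable (distr lborel borel ?T) F" using F_int by (simp add: lborel_distr_plus)
    then have "integrable lborel (\<lambda>x. F (x + h n *\<^sub>R ?v))"
      by (subst (asm) integrable_distr_eq) (auto simp: add.commute)
    then show ?thesis unfolding q_def using F_int eq by simp
  qed
  moreover have "(\<lambda>n. LINT x|lborel. q n x) \<longlonglongrightarrow> (LINT x|lborel. partial k F x)"
  proof (rule integral_dominated_convergence)
    show "integrable lborel (\<lambda>x. M * indicator (cball 0 (R + 1)) x)"
      using emeasure_compact_finite[OF compact_cball[of 0 "R + 1"]]
      by (intro integrable_mult_right integrable_real_indicator) auto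
    show "AE x in lborel. norm (q n x) \<le> M * indicator (cball 0 (R + 1)) x" for n
      using bound by simp
    have lim: "filterlim h (at 0) sequentially"
      using LIMSEQ_inverse_real_of_nat h unfolding h_def filterlim_at by (auto simp: less_imp_neq[symmetric])
    have "(\<lambda>n. q n x) \<longlonglongrightarrow> partial k F x" for x
      using filterlim_compose[OF line[of x 0, unfolded DERIV_def] lim] by (simp add: q_def)
    then show "AE x in lborel. (\<lambda>n. q n x) \<longlonglongrightarrow> partial k F x" by simp
  qed auto
  ultimately show ?thesis by (simp add: LIMSEQ_const_iff)
qed

lemma Ck_coordinate: "Ck m (\<lambda>x::real^'d. e \<bullet> x)"
proof (cases m)
  case 0 then show ?thesis by (simp add: continuous_intros)
next
  case (Suc m')
  have D: "((\<lambda>x. e \<bullet> x) has_derivative (\<lambda>v. e \<bullet> v)) (at x)" for x :: "real^'d"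
    by (auto intro!: derivative_eq_intros)
  have "partial k (\<lambda>x. e \<bullet> x) = (\<lambda>x. e \<bullet> axis k 1)" for k
    by (rule ext) (rule partial_eq[OF D])
  then show ?thesis using Suc D by (auto simp: differentiable_def Ck_const)
qed

text \<open>The divergence theorem for \<open>x \<mapsto> (e \<bullet> x) \<phi>(x)\<close>, which is compactly supported in \<open>\<Omega>\<close>. It makes
  the gradient of the hydraulic head \<open>u + z\<close> meaningful.\<close>

lemma has_weak_grad_linear:
  fixes e :: "real^'d"
  assumes "open \<Omega>" "bounded \<Omega>"
  shows "has_weak_grad \<Omega> (\<lambda>x. e \<bullet> x) (\<lambda>x. e)"
proof -
  have m: "\<Omega> \<in> lmeasurable" using assms by (rule lmeasurable_open[rotated])
  then have \<Omega>: "\<Omega> \<in> sets lebesgue" by (rule fmeasurableD)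
  have e_L2: "(\<lambda>x. e) \<in> L2 \<Omega>" by (rule L2_bounded[OF m]) auto
  have "(LINT x|lebesgue_on \<Omega>. (e \<bullet> x) *\<^sub>R classical_grad \<phi> x) = - (LINT x|lebesgue_on \<Omega>. \<phi> x *\<^sub>R e)"
    if \<phi>: "\<phi> \<in> test_functions \<Omega>" for \<phi>
  proof (subst vec_eq_iff, rule allI)
    fix k
    obtain R where R: "\<And>x. x \<in> \<Omega> \<Longrightarrow> norm x \<le> R" using assms(2) by (auto simp: bounded_iff)
    have z_L2: "(\<lambda>x. e \<bullet> x) \<in> L2 \<Omega>"
    proof (rule L2_bounded[OF m, of _ "norm e * R"])
      show "(\<lambda>x. e \<bullet> x) \<in> borel_measurable (lebesgue_on \<Omega>)"
        by (intro continuous_lebesgue_on_measurable continuous_intros)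
      show "norm (e \<bullet> x) \<le> norm e * R" if "x \<in> \<Omega>" for x
        using Cauchy_Schwarz_ineq2[of e x] R[OF that] mult_left_mono[of "norm x" R "norm e"] by simp
    qed
    let ?F = "\<lambda>x. (e \<bullet> x) * \<phi> x"
    have Ck\<phi>: "Ck m \<phi>" for m using \<phi> by (simp add: test_functions_def)
    have CkF: "Ck (Suc 0) ?F" by (intro Ck_mult Ck_coordinate Ck\<phi>)
    have supp: "closure {x. \<phi> x \<noteq> 0} \<subseteq> \<Omega>" "compact (closure {x. \<phi> x \<noteq> 0})"
      using \<phi> by (auto simp: test_functions_def)
    have sub: "closure {x. ?F x \<noteq> 0} \<subseteq> closure {x. \<phi> x \<noteq> 0}" by (rule closure_mono) auto
    have diff: "(\<lambda>x. e \<bullet> x) differentiable (at x)" "\<phi> differentiable (at x)" for x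
      using Ck_coordinate[of "Suc 0" e] Ck\<phi>[of "Suc 0"] by auto
    have coord: "partial k (\<lambda>x. e \<bullet> x) x = e $ k" for x
      by (subst partial_eq[of _ "\<lambda>v. e \<bullet> v"]) (auto intro!: derivative_eq_intros simp: inner_axis)
    have P: "partial k ?F x = (e \<bullet> x) * classical_grad \<phi> x $ k + \<phi> x * e $ k" for x
      using partial_mult[OF diff] by (simp add: coord classical_grad_def mult.commute)
    have i1: "integrable (lebesgue_on \<Omega>) (\<lambda>x. (e \<bullet> x) *\<^sub>R classical_grad \<phi> x)"
      by (rule L2_scaleR_integrable[OF z_L2 classical_grad_L2[OF m \<phi>]])
    have i2: "integrable (lebesgue_on \<Omega>) (\<lambda>x. \<phi> x *\<^sub>R e)"
      by (rule L2_scaleR_integrable[OF test_function_L2[OF m \<phi>] e_L2])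
    have nth: "(\<integral>x. f x \<partial>lebesgue_on \<Omega>) $ k = (\<integral>x. f x $ k \<partial>lebesgue_on \<Omega>) \<and>
        integrable (lebesgue_on \<Omega>) (\<lambda>x. f x $ k)"
      if "integrable (lebesgue_on \<Omega>) f" for f :: "real^'d \<Rightarrow> real^'d"
      using integral_bounded_linear[OF bounded_linear_vec_nth that, of k]
        integrable_bounded_linear[OF bounded_linear_vec_nth that, of k] by simp
    have "0 = (LINT x|lborel. partial k ?F x)"
      using integral_partial_eq_0[OF CkF compact_closure_subset[OF supp(2) sub]] by simp
    also have "\<dots> = (LINT x|lebesgue. partial k ?F x)"
      using CkF by (intro integral_completion[symmetric]) (simp add: borel_measurable_continuous_onI)
    also have "\<dots> = (LINT x|lebesgue. indicator \<Omega> x *\<^sub>R partial k ?F x)"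
    proof (rule Bochner_Integration.integral_cong)
      show "partial k ?F x = indicator \<Omega> x *\<^sub>R partial k ?F x" for x
        using partial_eq_0_outside_support[of x ?F k] sub supp(1) by (cases "x \<in> \<Omega>") auto
    qed simp
    also have "\<dots> = (LINT x|lebesgue_on \<Omega>. partial k ?F x)"
      using \<Omega> by (simp add: integral_restrict_space)
    also have "\<dots> = (LINT x|lebesgue_on \<Omega>. ((e \<bullet> x) *\<^sub>R classical_grad \<phi> x) $ k)
        + (LINT x|lebesgue_on \<Omega>. (\<phi> x *\<^sub>R e) $ k)"
      unfolding P using nth[OF i1] nth[OF i2] by simp
    finally show "(LINT x|lebesgue_on \<Omega>. (e \<bullet> x) *\<^sub>R classical_grad \<phi> x) $ k
        = (- (LINT x|lebesgue_on \<Omega>. \<phi> x *\<^sub>R e)) $ k"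
      using nth[OF i1] nth[OF i2] by simp
  qed
  then show ?thesis using e_L2 by (simp add: has_weak_grad_def)
qed

text \<open>Since \<^const>\<open>grad\<close> is an arbitrary choice of representative, all linearity of gradients is
  obtained from this uniqueness.\<close>

lemma weak_grad_unique:
  assumes "open \<Omega>" "bounded \<Omega>" and g: "has_weak_grad \<Omega> u g" and h: "has_weak_grad \<Omega> u h"
  shows "AE x in lebesgue_on \<Omega>. g x = h x"
proof -
  have m: "\<Omega> \<in> lmeasurable" using assms by (intro lmeasurable_open)
  have L2: "g \<in> L2 \<Omega>" "h \<in> L2 \<Omega>" using g h by (auto simp: has_weak_grad_def)
  have one: "(\<lambda>x. 1::real) \<in> L2 \<Omega>" by (rule L2_bounded[OF m]) auto
  have "AE x in lebesgue_on \<Omega>. (g x - h x) $ k = 0" for k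
  proof (rule fundamental_lemma_calculus_of_variations[OF \<open>open \<Omega>\<close>])
    show "integrable (lebesgue_on \<Omega>) (\<lambda>x. (g x - h x) $ k)"
      using integrable_bounded_linear[OF bounded_linear_vec_nth
          L2_scaleR_integrable[OF one L2_diff[OF L2]]] by simp
    fix \<phi> assume \<phi>: "\<phi> \<in> test_functions \<Omega>"
    have ig: "integrable (lebesgue_on \<Omega>) (\<lambda>x. \<phi> x *\<^sub>R g x)" "integrable (lebesgue_on \<Omega>) (\<lambda>x. \<phi> x *\<^sub>R h x)"
      by (intro L2_scaleR_integrable test_function_L2[OF m \<phi>] L2)+
    have "(LINT x|lebesgue_on \<Omega>. \<phi> x *\<^sub>R g x) = (LINT x|lebesgue_on \<Omega>. \<phi> x *\<^sub>R h x)"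
    proof -
      have "(LINT x|lebesgue_on \<Omega>. u x *\<^sub>R classical_grad \<phi> x) = - (LINT x|lebesgue_on \<Omega>. \<phi> x *\<^sub>R g x)"
        "(LINT x|lebesgue_on \<Omega>. u x *\<^sub>R classical_grad \<phi> x) = - (LINT x|lebesgue_on \<Omega>. \<phi> x *\<^sub>R h x)"
        using g h \<phi> unfolding has_weak_grad_def by blast+
      then show ?thesis by simp
    qed
    then have 0: "(LINT x|lebesgue_on \<Omega>. \<phi> x *\<^sub>R (g x - h x)) = 0"
      using ig by (simp add: scaleR_diff_right)
    have "(LINT x|lebesgue_on \<Omega>. \<phi> x * (g x - h x) $ k) = (LINT x|lebesgue_on \<Omega>. \<phi> x *\<^sub>R (g x - h x)) $ k"
      using integral_bounded_linear[OF bounded_linear_vec_nth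
          L2_scaleR_integrable[OF test_function_L2[OF m \<phi>] L2_diff[OF L2]], of k] by simp
    then show "(LINT x|lebesgue_on \<Omega>. \<phi> x * (g x - h x) $ k) = 0" using 0 by simp
  qed
  then have "AE x in lebesgue_on \<Omega>. \<forall>k. (g x - h x) $ k = 0"
    by (subst AE_all_countable) auto
  then show ?thesis by eventually_elim (simp add: vec_eq_iff)
qed

lemma has_weak_grad_linear_combination:
  assumes "open \<Omega>" "bounded \<Omega>" "u \<in> L2 \<Omega>" "v \<in> L2 \<Omega>"
    and g: "has_weak_grad \<Omega> u g" and h: "has_weak_grad \<Omega> v h"
  shows "has_weak_grad \<Omega> (\<lambda>x. u x + c * v x) (\<lambda>x. g x + c *\<^sub>R h x)"
proof -
  have m: "\<Omega> \<in> lmeasurable" using assms by (intro lmeasurable_open)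
  have L2: "g \<in> L2 \<Omega>" "h \<in> L2 \<Omega>" using g h by (auto simp: has_weak_grad_def)
  have "(LINT x|lebesgue_on \<Omega>. (u x + c * v x) *\<^sub>R classical_grad \<phi> x)
      = - (LINT x|lebesgue_on \<Omega>. \<phi> x *\<^sub>R (g x + c *\<^sub>R h x))"
    if \<phi>: "\<phi> \<in> test_functions \<Omega>" for \<phi>
  proof -
    note i = L2_scaleR_integrable[OF assms(3) classical_grad_L2[OF m \<phi>]]
      L2_scaleR_integrable[OF assms(4) classical_grad_L2[OF m \<phi>]]
      L2_scaleR_integrable[OF test_function_L2[OF m \<phi>] L2(1)]
      L2_scaleR_integrable[OF test_function_L2[OF m \<phi>] L2(2)]
    have "(LINT x|lebesgue_on \<Omega>. (u x + c * v x) *\<^sub>R classical_grad \<phi> x)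
        = (LINT x|lebesgue_on \<Omega>. u x *\<^sub>R classical_grad \<phi> x + c *\<^sub>R (v x *\<^sub>R classical_grad \<phi> x))"
      by (simp add: scaleR_add_left)
    also have "\<dots> = (LINT x|lebesgue_on \<Omega>. u x *\<^sub>R classical_grad \<phi> x)
        + c *\<^sub>R (LINT x|lebesgue_on \<Omega>. v x *\<^sub>R classical_grad \<phi> x)"
      using i by (subst Bochner_Integration.integral_add) (auto simp del: scaleR_scaleR)
    also have "\<dots> = - ((LINT x|lebesgue_on \<Omega>. \<phi> x *\<^sub>R g x) + c *\<^sub>R (LINT x|lebesgue_on \<Omega>. \<phi> x *\<^sub>R h x))"
      using g h \<phi> by (simp add: has_weak_grad_def)
    also have "(LINT x|lebesgue_on \<Omega>. \<phi> x *\<^sub>R g x) + c *\<^sub>R (LINT x|lebesgue_on \<Omega>. \<phi> x *\<^sub>R h x)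
        = (LINT x|lebesgue_on \<Omega>. \<phi> x *\<^sub>R g x + c *\<^sub>R (\<phi> x *\<^sub>R h x))"
      using i by (subst Bochner_Integration.integral_add) (auto simp del: scaleR_scaleR)
    also have "\<dots> = (LINT x|lebesgue_on \<Omega>. \<phi> x *\<^sub>R (g x + c *\<^sub>R h x))"
      by (simp add: scaleR_add_right mult.commute)
    finally show ?thesis .
  qed
  then show ?thesis
    using L2_add[OF L2(1) L2_scaleR[OF L2(2)]] by (simp add: has_weak_grad_def)
qed

lemma has_weak_grad_grad: "u \<in> H1 \<Omega> \<Longrightarrow> has_weak_grad \<Omega> u (grad \<Omega> u)"
  using someI_ex[of "has_weak_grad \<Omega> u"] by (simp add: grad_def H1_def)

lemma grad_linear_combination_AE:
  assumes "open \<Omega>" "bounded \<Omega>" "u \<in> H1 \<Omega>" "v \<in> H1 \<Omega>"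
  shows "(\<lambda>x. u x + c * v x) \<in> H1 \<Omega>"
    and "AE x in lebesgue_on \<Omega>. grad \<Omega> (\<lambda>x. u x + c * v x) x = grad \<Omega> u x + c *\<^sub>R grad \<Omega> v x"
proof -
  have L2: "u \<in> L2 \<Omega>" "v \<in> L2 \<Omega>" using assms by (auto simp: H1_def)
  have w: "has_weak_grad \<Omega> (\<lambda>x. u x + c * v x) (\<lambda>x. grad \<Omega> u x + c *\<^sub>R grad \<Omega> v x)"
    using assms by (intro has_weak_grad_linear_combination L2 has_weak_grad_grad)
  then show H1: "(\<lambda>x. u x + c * v x) \<in> H1 \<Omega>"
    using L2_add[OF L2(1) L2_scaleR[OF L2(2), of c]] by (auto simp: H1_def)
  show "AE x in lebesgue_on \<Omega>. grad \<Omega> (\<lambda>x. u x + c * v x) x = grad \<Omega> u x + c *\<^sub>R grad \<Omega> v x"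
    by (rule weak_grad_unique[OF assms(1,2) has_weak_grad_grad[OF H1] w])
qed

lemma ennreal_power2_strict_mono:
  fixes x y :: ennreal
  assumes "x < y"
  shows "x\<^sup>2 < y\<^sup>2"
proof (cases "y = top")
  case True
  then show ?thesis using assms by (simp add: power_less_top_ennreal)
next
  case False
  then obtain a b where "x = ennreal a" "y = ennreal b" "0 \<le> a" "0 \<le> b"
    using assms by (cases x; cases y) auto
  then show ?thesis using assms by (auto simp: ennreal_power ennreal_less_iff power_strict_mono)
qed

text \<open>Differences of approximating test functions approximate the difference. Halving the tolerance
  suffices because \<open>|a - b|\<^sup>2 \<le> 2 |a|\<^sup>2 + 2 |b|\<^sup>2\<close>, which replaces the triangle inequality in
  \<open>L2\<close>.\<close>

lemma H10_diff:
  assumes \<Omega>: "open \<Omega>" "bounded \<Omega>" and u: "u \<in> H10 \<Omega>" and v: "v \<in> H10 \<Omega>"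
  shows "(\<lambda>x. u x - v x) \<in> H10 \<Omega>"
proof -
  have m: "\<Omega> \<in> lmeasurable" using \<Omega> by (intro lmeasurable_open)
  have H1: "u \<in> H1 \<Omega>" "v \<in> H1 \<Omega>" using u v by (auto simp: H10_def)
  note diff = grad_linear_combination_AE[OF \<Omega> H1, of "-1", simplified]
  have gL2: "grad \<Omega> w \<in> L2 \<Omega>" if "w \<in> H1 \<Omega>" for w
    using has_weak_grad_grad[OF that] by (simp add: has_weak_grad_def)
  have close: "L2_norm \<Omega> (\<lambda>x. c x - d x) < ennreal e"
    if "L2_norm \<Omega> a < ennreal (e / 2)" "L2_norm \<Omega> b < ennreal (e / 2)" "0 < e"
      "a \<in> L2 \<Omega>" "b \<in> L2 \<Omega>" "AE x in lebesgue_on \<Omega>. c x - d x = a x - b x"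
    for a b c d :: "real^'a \<Rightarrow> 'b::euclidean_space" and e
  proof -
    note [measurable] = that(4,5)[THEN L2_measurable]
    have "(L2_norm \<Omega> (\<lambda>x. c x - d x))\<^sup>2 \<le>
        (\<integral>\<^sup>+x. 2 * ennreal ((norm (a x))\<^sup>2) + 2 * ennreal ((norm (b x))\<^sup>2) \<partial>lebesgue_on \<Omega>)"
      unfolding L2_normD
    proof (intro nn_integral_mono_AE)
      show "AE x in lebesgue_on \<Omega>. ennreal ((norm (c x - d x))\<^sup>2)
          \<le> 2 * ennreal ((norm (a x))\<^sup>2) + 2 * ennreal ((norm (b x))\<^sup>2)"
        using that(6)
      proof eventually_elim
        case (elim x)
        have "(norm (c x - d x))\<^sup>2 \<le> 2 * (norm (a x))\<^sup>2 + 2 * (norm (b x))\<^sup>2"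
          using power2_norm_add_le[of "a x" "- b x"] elim by simp
        then have "ennreal ((norm (c x - d x))\<^sup>2) \<le> ennreal (2 * (norm (a x))\<^sup>2 + 2 * (norm (b x))\<^sup>2)"
          by (rule ennreal_leI)
        then show ?case by (simp add: ennreal_mult)
      qed
    qed
    also have "\<dots> = 2 * (L2_norm \<Omega> a)\<^sup>2 + 2 * (L2_norm \<Omega> b)\<^sup>2"
      unfolding L2_normD by (simp add: nn_integral_add nn_integral_cmult)
    also have "\<dots> < 2 * (ennreal (e / 2))\<^sup>2 + 2 * (ennreal (e / 2))\<^sup>2"
      using that(1,2) by (intro add_strict_mono ennreal_mult_strict_left_mono ennreal_power2_strict_mono) auto
    also have "\<dots> = (ennreal e)\<^sup>2"
    proof -
      have "2 * (ennreal (e / 2))\<^sup>2 = ennreal (e\<^sup>2 / 2)"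
        using \<open>0 < e\<close> ennreal_mult[of 2 "(e / 2)\<^sup>2"] by (simp add: ennreal_power power_divide)
      then have "2 * (ennreal (e / 2))\<^sup>2 + 2 * (ennreal (e / 2))\<^sup>2 = ennreal (e\<^sup>2 / 2 + e\<^sup>2 / 2)"
        by (subst ennreal_plus) auto
      also have "e\<^sup>2 / 2 + e\<^sup>2 / 2 = e\<^sup>2" by simp
      finally show ?thesis using \<open>0 < e\<close> by (simp add: ennreal_power)
    qed
    finally show ?thesis by (meson leD leI power_mono zero_le)
  qed
  have "\<exists>\<phi>\<in>test_functions \<Omega>. L2_norm \<Omega> (\<lambda>x. (u x - v x) - \<phi> x) < ennreal e \<and>
      L2_norm \<Omega> (\<lambda>x. grad \<Omega> (\<lambda>x. u x - v x) x - classical_grad \<phi> x) < ennreal e" if e: "e > 0" for e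
  proof -
    obtain \<phi> where \<phi>: "\<phi> \<in> test_functions \<Omega>" "L2_norm \<Omega> (\<lambda>x. u x - \<phi> x) < ennreal (e / 2)"
        "L2_norm \<Omega> (\<lambda>x. grad \<Omega> u x - classical_grad \<phi> x) < ennreal (e / 2)"
      using u e unfolding H10_def by (auto dest!: spec[of _ "e / 2"])
    obtain \<psi> where \<psi>: "\<psi> \<in> test_functions \<Omega>" "L2_norm \<Omega> (\<lambda>x. v x - \<psi> x) < ennreal (e / 2)"
        "L2_norm \<Omega> (\<lambda>x. grad \<Omega> v x - classical_grad \<psi> x) < ennreal (e / 2)"
      using v e unfolding H10_def by (auto dest!: spec[of _ "e / 2"])
    note t = test_functions_diff[OF \<phi>(1) \<psi>(1)]
    have "L2_norm \<Omega> (\<lambda>x. (u x - v x) - (\<phi> x - \<psi> x)) < ennreal e"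
      using H1 test_function_L2[OF m \<phi>(1)] test_function_L2[OF m \<psi>(1)]
      by (intro close[OF \<phi>(2) \<psi>(2) e] L2_diff) (auto simp: H1_def)
    moreover have "L2_norm \<Omega> (\<lambda>x. grad \<Omega> (\<lambda>x. u x - v x) x - classical_grad (\<lambda>x. \<phi> x - \<psi> x) x) < ennreal e"
    proof (rule close[OF \<phi>(3) \<psi>(3) e])
      show "AE x in lebesgue_on \<Omega>. grad \<Omega> (\<lambda>x. u x - v x) x - classical_grad (\<lambda>x. \<phi> x - \<psi> x) x
          = (grad \<Omega> u x - classical_grad \<phi> x) - (grad \<Omega> v x - classical_grad \<psi> x)"
        using diff(2) by eventually_elim (simp add: classical_grad_diff[OF \<phi>(1) \<psi>(1)])
    qed (intro L2_diff gL2 H1 classical_grad_L2[OF m \<phi>(1)] classical_grad_L2[OF m \<psi>(1)])+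
    ultimately show ?thesis by (intro bexI[OF _ t] conjI)
  qed
  then show ?thesis using diff(1) by (simp add: H10_def)
qed

text \<open>The parameter \<open>s\<close> is kept free: below it is the size of the second factor, so that both terms
  are of order \<open>s\<close>.\<close>

lemma young_inner:
  assumes "0 < s"
  shows "\<bar>a \<bullet> b\<bar> \<le> s / 2 * (norm a)\<^sup>2 + 1 / (2 * s) * (norm b)\<^sup>2"
proof -
  have "0 \<le> (s * norm a - norm b)\<^sup>2" by simp
  then have "2 * s * (norm a * norm b) \<le> s\<^sup>2 * (norm a)\<^sup>2 + (norm b)\<^sup>2"
    by (simp add: power2_diff power_mult_distrib)
  then have "norm a * norm b \<le> (s\<^sup>2 * (norm a)\<^sup>2 + (norm b)\<^sup>2) / (2 * s)"
    using assms by (simp add: field_simps)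
  also have "\<dots> = s / 2 * (norm a)\<^sup>2 + 1 / (2 * s) * (norm b)\<^sup>2"
    using assms by (simp add: field_simps power2_eq_square)
  finally show ?thesis using Cauchy_Schwarz_ineq2[of a b] by linarith
qed

lemma L2_inner_young:
  assumes "u \<in> L2 S" "v \<in> L2 S" "0 < s" "L2_norm S v < ennreal s"
  shows "\<bar>L2_inner S u v\<bar> \<le> s / 2 * ((LINT x|lebesgue_on S. (norm (u x))\<^sup>2) + 1)"
proof -
  have iu: "integrable (lebesgue_on S) (\<lambda>x. (norm (u x))\<^sup>2)"
    and iv: "integrable (lebesgue_on S) (\<lambda>x. (norm (v x))\<^sup>2)" using assms(1,2) by (auto simp: L2_def)
  have "ennreal (LINT x|lebesgue_on S. (norm (v x))\<^sup>2) = (L2_norm S v)\<^sup>2"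
    unfolding L2_normD using iv by (intro nn_integral_eq_integral[symmetric]) auto
  also have "\<dots> \<le> (ennreal s)\<^sup>2" using assms(4) by (intro power_mono) auto
  finally have v: "(LINT x|lebesgue_on S. (norm (v x))\<^sup>2) \<le> s\<^sup>2"
    using assms(3) by (simp add: ennreal_power)
  have "\<bar>L2_inner S u v\<bar> \<le> (LINT x|lebesgue_on S. \<bar>u x \<bullet> v x\<bar>)"
    unfolding L2_inner_def by (rule integral_abs_bound)
  also have "\<dots> \<le> (LINT x|lebesgue_on S. s / 2 * (norm (u x))\<^sup>2 + 1 / (2 * s) * (norm (v x))\<^sup>2)"
    using iu iv L2_inner_integrable[OF assms(1,2)] young_inner[OF assms(3)]
    by (intro integral_mono) auto
  also have "\<dots> = s / 2 * (LINT x|lebesgue_on S. (norm (u x))\<^sup>2)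
      + 1 / (2 * s) * (LINT x|lebesgue_on S. (norm (v x))\<^sup>2)"
    using iu iv by simp
  also have "\<dots> \<le> s / 2 * (LINT x|lebesgue_on S. (norm (u x))\<^sup>2) + 1 / (2 * s) * s\<^sup>2"
    using v assms(3) by (intro add_left_mono mult_left_mono) auto
  also have "\<dots> = s / 2 * ((LINT x|lebesgue_on S. (norm (u x))\<^sup>2) + 1)"
    using assms(3) by (simp add: field_simps power2_eq_square)
  finally show ?thesis .
qed

text \<open>The definition of the weak divergence is tested with smooth functions only; it extends to
  \<open>H10\<close> because both sides are continuous in the norm of \<open>H1\<close>.\<close>

lemma weak_div_H10:
  assumes \<Omega>: "open \<Omega>" "bounded \<Omega>" and \<sigma>: "\<sigma> \<in> L2 \<Omega>" and div: "has_weak_div \<Omega> \<sigma> g" and u: "u \<in> H10 \<Omega>"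
  shows "L2_inner \<Omega> \<sigma> (grad \<Omega> u) = - L2_inner \<Omega> g u"
proof -
  have m: "\<Omega> \<in> lmeasurable" using \<Omega> by (intro lmeasurable_open)
  have uH: "u \<in> H1 \<Omega>" "u \<in> L2 \<Omega>" using u by (auto simp: H10_def H1_def)
  have gu: "grad \<Omega> u \<in> L2 \<Omega>" using has_weak_grad_grad[OF uH(1)] by (simp add: has_weak_grad_def)
  have g: "g \<in> L2 \<Omega>" using div by (simp add: has_weak_div_def)
  let ?d = "L2_inner \<Omega> \<sigma> (grad \<Omega> u) + L2_inner \<Omega> g u"
  define A where "A = (LINT x|lebesgue_on \<Omega>. (norm (\<sigma> x))\<^sup>2) + (LINT x|lebesgue_on \<Omega>. (norm (g x))\<^sup>2) + 2"
  have A: "A > 0" unfolding A_def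
    by (intro add_nonneg_pos add_nonneg_nonneg Bochner_Integration.integral_nonneg) auto
  have bound: "\<bar>?d\<bar> \<le> s / 2 * A" if s: "s > 0" for s
  proof -
    obtain \<phi> where \<phi>: "\<phi> \<in> test_functions \<Omega>" "L2_norm \<Omega> (\<lambda>x. u x - \<phi> x) < ennreal s"
        "L2_norm \<Omega> (\<lambda>x. grad \<Omega> u x - classical_grad \<phi> x) < ennreal s"
      using u s unfolding H10_def by blast
    note L2 = test_function_L2[OF m \<phi>(1)] classical_grad_L2[OF m \<phi>(1)]
    have "L2_inner \<Omega> \<sigma> (\<lambda>x. grad \<Omega> u x - classical_grad \<phi> x)
        = L2_inner \<Omega> \<sigma> (grad \<Omega> u) - L2_inner \<Omega> \<sigma> (classical_grad \<phi>)"
      unfolding L2_inner_def inner_diff_right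
      by (intro Bochner_Integration.integral_diff L2_inner_integrable \<sigma> gu L2)
    moreover have "L2_inner \<Omega> g (\<lambda>x. u x - \<phi> x) = L2_inner \<Omega> g u - L2_inner \<Omega> g \<phi>"
      unfolding L2_inner_def inner_diff_right
      by (intro Bochner_Integration.integral_diff L2_inner_integrable g uH L2)
    moreover have "L2_inner \<Omega> \<sigma> (classical_grad \<phi>) = - L2_inner \<Omega> g \<phi>"
      using div \<phi>(1) by (simp add: has_weak_div_def)
    ultimately have "?d = L2_inner \<Omega> \<sigma> (\<lambda>x. grad \<Omega> u x - classical_grad \<phi> x)
        + L2_inner \<Omega> g (\<lambda>x. u x - \<phi> x)" by simp
    then show ?thesis
      using L2_inner_young[OF \<sigma> L2_diff[OF gu L2(2)] s \<phi>(3)]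
        L2_inner_young[OF g L2_diff[OF uH(2) L2(1)] s \<phi>(2)]
      unfolding A_def by (simp add: algebra_simps)
  qed
  have "?d = 0"
  proof (rule ccontr)
    assume "?d \<noteq> 0"
    then have "\<bar>?d\<bar> / A > 0" using A by simp
    from bound[OF this] have "\<bar>?d\<bar> \<le> \<bar>?d\<bar> / 2" using A by simp
    then show False using \<open>?d \<noteq> 0\<close> by simp
  qed
  then show ?thesis by simp
qed

section \<open>Finite element functions\<close>

lemma polys_zero: "(\<lambda>x. 0) \<in> polys p"
  by (auto simp: polys_def intro!: exI[of _ "\<lambda>a. 0"])

lemma polys_diff:
  assumes "q \<in> polys p" "r \<in> polys p"
  shows "(\<lambda>x. q x - r x) \<in> polys p"
proof -
  obtain c d where "\<And>x. q x = (\<Sum>a\<in>multi_indices p. c a * (\<Prod>k\<in>UNIV. x $ k ^ a k))"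
      "\<And>x. r x = (\<Sum>a\<in>multi_indices p. d a * (\<Prod>k\<in>UNIV. x $ k ^ a k))"
    using assms by (auto simp: polys_def)
  then show ?thesis
    by (auto simp: polys_def left_diff_distrib sum_subtractf intro!: exI[of _ "\<lambda>a. c a - d a"])
qed

lemma Vh_diff:
  assumes "open \<Omega>" "bounded \<Omega>" "u \<in> Vh \<Omega> p \<T>" "v \<in> Vh \<Omega> p \<T>"
  shows "(\<lambda>x. u x - v x) \<in> Vh \<Omega> p \<T>"
proof -
  have "\<exists>q\<in>polys p. \<forall>x\<in>E. u x - v x = q x" if E: "E \<in> \<T>" for E
  proof -
    obtain q where "q \<in> polys p" "\<forall>x\<in>E. u x = q x" using assms(3) E by (auto simp: Vh_def)
    moreover obtain r where "r \<in> polys p" "\<forall>x\<in>E. v x = r x" using assms(4) E by (auto simp: Vh_def)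
    ultimately show ?thesis using polys_diff[of q p r] by (intro bexI[of _ "\<lambda>x. q x - r x"]) auto
  qed
  then show ?thesis using assms by (simp add: Vh_def H10_diff)
qed

text \<open>Two distinct elements meet in a common face of both. It is a proper face of at least one of them,
  hence of lower dimension.\<close>

lemma mesh_elements:
  fixes \<T> :: "(real^'d) set set"
  assumes "mesh_of \<Omega> \<T>"
  shows "finite \<T>" "\<And>E. E \<in> \<T> \<Longrightarrow> compact E"
    and "\<And>E E'. E \<in> \<T> \<Longrightarrow> E' \<in> \<T> \<Longrightarrow> E \<noteq> E' \<Longrightarrow> negligible (E \<inter> E')"
proof -
  have tri: "triangulation \<T>" and simplex: "\<And>E. E \<in> \<T> \<Longrightarrow> int CARD('d) simplex E"
    using assms by (auto simp: mesh_of_def)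
  show "finite \<T>" using tri by (simp add: triangulation_def)
  show "compact E" if "E \<in> \<T>" for E using simplex[OF that] by (rule compact_simplex)
  fix E E' assume E: "E \<in> \<T>" "E' \<in> \<T>" "E \<noteq> E'"
  have conv: "convex E" "convex E'" using E simplex convex_simplex by blast+
  have dim: "aff_dim E = CARD('d)" "aff_dim E' = CARD('d)"
    using E simplex aff_dim_simplex by blast+
  have face: "E \<inter> E' face_of E" "E' \<inter> E face_of E'" using tri E by (auto simp: triangulation_def)
  have "aff_dim (E \<inter> E') < CARD('d)"
  proof (cases "E \<inter> E' = E")
    case False
    then show ?thesis using face_of_aff_dim_lt[OF conv(1) face(1)] dim by simp
  next
    case True
    then have "E' \<inter> E \<noteq> E'" using E by blast
    then show ?thesis using face_of_aff_dim_lt[OF conv(2) face(2)] dim by (simp add: Int_commute)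
  qed
  then have "interior (E \<inter> E') = {}" by (intro low_dim_interior) simp
  then show "negligible (E \<inter> E')"
    using conv by (simp add: negligible_convex_interior convex_Int)
qed

text \<open>Cutting off at element boundaries leaves a piecewise polynomial, because elements outside \<open>D\<close>
  meet \<open>\<Union>D\<close> in a null set. This is the test function to which the orthogonality of the projection
  is applied.\<close>

lemma Vh_cutoff_broken_poly:
  fixes \<T> :: "(real^'d) set set"
  assumes mesh: "mesh_of \<Omega> \<T>" and v: "v \<in> Vh \<Omega> p \<T>" and D: "D \<subseteq> \<T>"
  shows "(\<lambda>x. indicator (\<Union>D) x * v x) \<in> broken_polys p \<T>"
  unfolding broken_polys_def
proof (intro CollectI ballI)
  fix E assume E: "E \<in> \<T>"
  show "\<exists>q\<in>polys p. AE x in lebesgue_on E. indicator (\<Union>D) x * v x = q x"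
  proof (cases "E \<in> D")
    case True
    obtain q where "q \<in> polys p" "\<forall>x\<in>E. v x = q x" using v E by (auto simp: Vh_def)
    moreover have "\<forall>x\<in>E. indicator (\<Union>D) x = (1::real)" using True by (auto simp: indicator_def)
    ultimately show ?thesis
      by (intro bexI[of _ q]) (auto intro!: AE_I2 simp: space_restrict_space)
  next
    case False
    have "negligible (\<Union>E'\<in>D. E \<inter> E')"
      using mesh_elements[OF mesh] E D False finite_subset[OF D]
      by (intro negligible_Union) (auto intro: negligible_Union)
    then have "AE x in lebesgue. x \<notin> (\<Union>E'\<in>D. E \<inter> E')"
      unfolding negligible_iff_null_sets by (rule AE_not_in)
    moreover have "E \<in> sets lebesgue" using mesh_elements(2)[OF mesh E] by (simp add: lmeasurable_compact fmeasurableD)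
    ultimately have "AE x in lebesgue_on E. indicator (\<Union>D) x * v x = 0"
      by (auto simp: AE_restrict_space_iff indicator_def elim!: eventually_mono)
    then show ?thesis using polys_zero by (intro bexI[of _ "\<lambda>x. 0"]) auto
  qed
qed

section \<open>The energy estimate\<close>

lemma ennreal_add_le: "ennreal (x + y) \<le> ennreal x + ennreal y"
proof -
  have "ennreal (x + y) \<le> ennreal (max 0 x + max 0 y)" by (intro ennreal_leI) auto
  also have "\<dots> = ennreal (max 0 x) + ennreal (max 0 y)" by (rule ennreal_plus) auto
  finally show ?thesis by (simp add: max_def ennreal_neg split: if_splits)
qed

text \<open>The integrands of the estimators contain square roots of a coefficient field; they enter only as
  upper bounds \<open>P\<close>, through monotonicity of the nonnegative integral.\<close>

lemma ennreal_integral_le_nn_integral: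
  fixes w :: "'a \<Rightarrow> real"
  assumes "integrable M w" "AE x in M. ennreal (w x) \<le> P x"
  shows "ennreal (\<integral>x. w x \<partial>M) \<le> (\<integral>\<^sup>+x. P x \<partial>M)"
proof -
  have "(\<integral>x. w x \<partial>M) \<le> (\<integral>x. max 0 (w x) \<partial>M)"
    using assms(1) by (intro integral_mono integrable_max) auto
  then have "ennreal (\<integral>x. w x \<partial>M) \<le> ennreal (\<integral>x. max 0 (w x) \<partial>M)" by (rule ennreal_leI)
  also have "\<dots> = (\<integral>\<^sup>+x. ennreal (max 0 (w x)) \<partial>M)"
    using assms(1) by (intro nn_integral_eq_integral[symmetric] integrable_max) auto
  also have "\<dots> \<le> (\<integral>\<^sup>+x. P x \<partial>M)"
    using assms(2) by (intro nn_integral_mono_AE) (auto elim!: eventually_mono simp: max_def ennreal_neg)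
  finally show ?thesis .
qed

text \<open>The algebra of the final estimate. The energy \<open>X = \<integral>N1 + \<tau> \<integral>N2\<close> equals a sum of three terms;
  \<open>d\<close> absorbs the fraction \<open>1 - c\<close> of it, so \<open>c X \<le> \<integral>a + \<tau> \<integral>b\<close>. Applying Young's inequality
  pointwise to \<open>a\<close> and \<open>b\<close>, with the weight chosen such that another \<open>c X / 2\<close> is absorbed,
  yields \<open>c\<^sup>2 X \<le> \<integral>P + \<tau> \<integral>Q\<close>. This is as sharp as the Cauchy-Schwarz inequality for integrals
  and works with possibly infinite right-hand sides.\<close>

lemma absorbed_energy_bound:
  fixes N1 N2 a b d :: "'a \<Rightarrow> real"
  assumes int: "integrable M N1" "integrable M N2" "integrable M a" "integrable M b" "integrable M d"
    and "0 \<le> \<tau>" "0 < c"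
    and identity: "integral\<^sup>L M N1 + \<tau> * integral\<^sup>L M N2 =
        integral\<^sup>L M a + \<tau> * integral\<^sup>L M b + integral\<^sup>L M d"
    and d: "AE x in M. d x \<le> (1 - c) * (N1 x + \<tau> * N2 x)"
    and a: "AE x in M. ennreal (2 * c * a x - c\<^sup>2 * N1 x) \<le> P x"
    and b: "AE x in M. ennreal (2 * c * b x - c\<^sup>2 * N2 x) \<le> Q x"
  shows "ennreal (c\<^sup>2 * (integral\<^sup>L M N1 + \<tau> * integral\<^sup>L M N2))
    \<le> (\<integral>\<^sup>+x. P x \<partial>M) + ennreal \<tau> * (\<integral>\<^sup>+x. Q x \<partial>M)"
proof -
  let ?A = "2 * c * integral\<^sup>L M a - c\<^sup>2 * integral\<^sup>L M N1"
  let ?B = "2 * c * integral\<^sup>L M b - c\<^sup>2 * integral\<^sup>L M N2"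
  let ?X = "integral\<^sup>L M N1 + \<tau> * integral\<^sup>L M N2"
  have A: "ennreal ?A \<le> (\<integral>\<^sup>+x. P x \<partial>M)"
    using ennreal_integral_le_nn_integral[OF _ a] int by simp
  have B: "ennreal ?B \<le> (\<integral>\<^sup>+x. Q x \<partial>M)"
    using ennreal_integral_le_nn_integral[OF _ b] int by simp
  have "integral\<^sup>L M d \<le> (\<integral>x. (1 - c) * (N1 x + \<tau> * N2 x) \<partial>M)"
    using int d by (intro integral_mono_AE) auto
  also have "\<dots> = (1 - c) * ?X" using int by simp
  finally have "c * ?X \<le> integral\<^sup>L M a + \<tau> * integral\<^sup>L M b"
    using identity by (simp add: left_diff_distrib)
  then have "2 * c * (c * ?X) \<le> 2 * c * (integral\<^sup>L M a + \<tau> * integral\<^sup>L M b)"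
    using \<open>0 < c\<close> by (intro mult_left_mono) auto
  then have "c\<^sup>2 * ?X \<le> ?A + \<tau> * ?B" by (simp add: algebra_simps power2_eq_square)
  then have "ennreal (c\<^sup>2 * ?X) \<le> ennreal (?A + \<tau> * ?B)" by (rule ennreal_leI)
  also have "\<dots> \<le> ennreal ?A + ennreal \<tau> * ennreal ?B"
    using ennreal_add_le[of ?A "\<tau> * ?B"] \<open>0 \<le> \<tau>\<close> by (simp add: ennreal_mult')
  also have "\<dots> \<le> (\<integral>\<^sup>+x. P x \<partial>M) + ennreal \<tau> * (\<integral>\<^sup>+x. Q x \<partial>M)"
    by (intro add_mono mult_left_mono A B) auto
  finally show ?thesis .
qed

lemma borel_measurable_matrix_vector_mult:
  fixes A :: "'a \<Rightarrow> real^'n^'m"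
  assumes "A \<in> borel_measurable M" "g \<in> borel_measurable M"
  shows "(\<lambda>x. A x *v g x) \<in> borel_measurable M"
proof (rule borel_measurable_continuous_Pair[OF assms])
  show "continuous_on UNIV (\<lambda>x. fst x *v snd x :: real^'m)"
    unfolding matrix_vector_mult_def by (intro continuous_intros)
qed

lemma L2_matrix_field:
  fixes A :: "real^'d \<Rightarrow> real^'n^'m"
  assumes "A \<in> borel_measurable (lebesgue_on S)" "g \<in> L2 S" "\<And>x y. norm (A x *v y) \<le> M * norm y"
  shows "(\<lambda>x. A x *v g x) \<in> L2 S"
  by (rule L2_dominated[where M=M, OF assms(2) borel_measurable_matrix_vector_mult[OF assms(1) L2_measurable[OF assms(2)]]])
    (use assms(3) in simp)

text \<open>The mesh elements are closed and may exceed \<open>\<Omega>\<close> by boundary points, whence an inequality.\<close>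

lemma nn_integral_indicator_lebesgue_on_le:
  assumes "S \<in> sets lebesgue" "W \<in> sets lebesgue"
  shows "(\<integral>\<^sup>+x. indicator W x * F x \<partial>lebesgue_on S) \<le> (\<integral>\<^sup>+x. F x \<partial>lebesgue_on W)"
  using assms
  by (simp add: nn_integral_restrict_space) (auto intro!: nn_integral_mono simp: indicator_def)

theorem proposition1:
  fixes \<Omega> :: "(real^'d) set" and \<T> :: "(real^'d) set set" and p n i :: nat
    and Proj :: "(real^'d \<Rightarrow> real) \<Rightarrow> real^'d \<Rightarrow> real"
    and e :: "real^'d" and z :: "real^'d \<Rightarrow> real"
    and \<theta> \<theta>' :: "real \<Rightarrow> real" and K K\<theta>' :: "real \<Rightarrow> real^'d^'d"
    and L\<theta> \<theta>m \<kappa>m \<kappa>M L\<kappa> T L \<tau> \<epsilon> C\<^sub>N :: real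
    and f :: "real \<Rightarrow> real^'d \<Rightarrow> real"
    and \<psi>prev \<psi>N :: "real^'d \<Rightarrow> real" and \<psi> :: "nat \<Rightarrow> real^'d \<Rightarrow> real"
    and \<sigma> :: "real^'d \<Rightarrow> real^'d"
  assumes domain: "polytopal_lipschitz_domain \<Omega>"
    and mesh: "mesh_of \<Omega> \<T>"
    and proj: "is_L2_projection \<Omega> p \<T> Proj"
    and height: "norm e = 1" "\<And>x. z x = e \<bullet> x"
    and theta: "range \<theta> \<subseteq> {0..1}" "L\<theta>-lipschitz_on UNIV \<theta>" "mono \<theta>"
    and theta_deriv: "\<theta>' \<in> borel_measurable borel"
      "AE s in lborel. (\<theta> has_real_derivative \<theta>' s) (at s)"
      "0 \<le> \<theta>m" "\<And>s. \<theta>m \<le> \<theta>' s" "\<And>s. \<theta>' s \<le> L\<theta>"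
    and K_sym: "\<And>s. s \<in> {0..1} \<Longrightarrow> transpose (K s) = K s"
    and kappa: "0 \<le> \<kappa>m" "\<kappa>m < \<kappa>M"
    and K_bounds: "\<And>s y. s \<in> {0..1} \<Longrightarrow> \<kappa>m * (norm y)\<^sup>2 \<le> y \<bullet> (K s *v y)"
      "\<And>s y. s \<in> {0..1} \<Longrightarrow> y \<bullet> (K s *v y) \<le> \<kappa>M * (norm y)\<^sup>2"
    and K_lipschitz: "L\<kappa>-lipschitz_on UNIV (K \<circ> \<theta>)"
    and K_deriv: "K\<theta>' \<in> borel_measurable borel" "bounded (range K\<theta>')"
      "AE s in lborel. ((K \<circ> \<theta>) has_vector_derivative K\<theta>' s) (at s)"
    and params: "0 < L" "0 < \<tau>" "0 < \<epsilon>" "1 \<le> i"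
    and time: "1 \<le> n" "real n * \<tau> \<le> T"
    and source: "f \<in> C_time_L2 T \<Omega>"
    and prev_in: "\<psi>prev \<in> Vh \<Omega> p \<T>"
    and iter_in: "\<And>j. j \<le> i \<Longrightarrow> \<psi> j \<in> Vh \<Omega> p \<T>"
    and L_scheme: "\<And>j. 1 \<le> j \<Longrightarrow> j \<le> i \<Longrightarrow>
      L_scheme_step \<Omega> (Vh \<Omega> p \<T>) \<theta> K z L \<tau> (f (real n * \<tau>)) \<psi>prev (\<psi> (j - 1)) (\<psi> j)"
    and K_inv_sqrt: "AE x in lebesgue_on \<Omega>. invertible (matrix_sqrt (K (\<theta> (\<psi> i x))))"
    and newton_in: "\<psi>N \<in> Vh \<Omega> p \<T>"
    and newton: "Newton_step \<Omega> (Vh \<Omega> p \<T>) \<theta> \<theta>' K K\<theta>' z \<tau> (f (real n * \<tau>)) \<psi>prev (\<psi> i) \<psi>N"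
    and C_range: "0 \<le> C\<^sub>N" "C\<^sub>N < 2"
    and C_bound: "AE x in lebesgue_on \<Omega>.
      \<tau> * (norm (matrix_inv_sqrt (K (\<theta> (\<psi> i x))) *v
                  (K\<theta>' (\<psi> i x) *v grad \<Omega> (\<lambda>y. \<psi> i y + z y) x)))\<^sup>2
      \<le> C\<^sub>N\<^sup>2 * \<theta>' (\<psi> i x)"
    and sigma_in: "\<sigma> \<in> RT p \<T> \<inter> Hdiv \<Omega>"
    and sigma_div: "has_weak_div \<Omega> \<sigma>
      (\<lambda>x. if x \<in> \<Union>(degenerate_elements \<T> \<theta>' (\<psi> i) \<epsilon>)
            then 1 / \<tau> * Proj (L_residual \<theta> L (\<psi> (i - 1)) (\<psi> i)) x else 0)"
  shows "newton_norm \<Omega> \<theta> \<theta>' K \<tau> (\<psi> i) (\<lambda>x. \<psi>N x - \<psi> i x)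
    \<le> eta_L_to_N \<Omega> \<T> \<theta> \<theta>' K z L \<tau> \<epsilon> C\<^sub>N \<sigma> (\<psi> (i - 1)) (\<psi> i)"
proof -
  have \<Omega>: "open \<Omega>" "bounded \<Omega>" using domain by (auto simp: polytopal_lipschitz_domain_def)
  have m: "\<Omega> \<in> lmeasurable" using \<Omega> by (intro lmeasurable_open)
  have \<Omega>_sets: "\<Omega> \<in> sets lebesgue" using m by (rule fmeasurableD)
  let ?M = "lebesgue_on \<Omega>"
  define u where "u = \<psi> i"
  define u0 where "u0 = \<psi> (i - 1)"
  define \<delta> where "\<delta> x = \<psi>N x - u x" for x
  define r where "r = L_residual \<theta> L u0 u"
  define D where "D = degenerate_elements \<T> \<theta>' u \<epsilon>"
  define A where "A x = K (\<theta> (u x))" for x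
  define A0 where "A0 x = K (\<theta> (u0 x))" for x
  define gu where "gu = grad \<Omega> (\<lambda>y. u y + z y)"
  define g\<delta> where "g\<delta> = grad \<Omega> \<delta>"
  define H where "H x = K\<theta>' (u x) *v gu x" for x
  define G where "G x = (A x - A0 x) *v gu x + \<sigma> x" for x
  define c where "c = 1 - C\<^sub>N / 2"
  have c: "0 < c" using C_range by (simp add: c_def)

  have Vh: "u \<in> Vh \<Omega> p \<T>" "u0 \<in> Vh \<Omega> p \<T>" using iter_in by (auto simp: u_def u0_def)
  have \<delta>_Vh: "\<delta> \<in> Vh \<Omega> p \<T>" unfolding \<delta>_def using \<Omega> newton_in Vh by (intro Vh_diff)
  have Vh_H1: "v \<in> H1 \<Omega>" "v \<in> L2 \<Omega>" if "v \<in> Vh \<Omega> p \<T>" for v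
    using that by (auto simp: Vh_def H10_def H1_def)
  note L2s = Vh_H1(2)[OF Vh(1)] Vh_H1(2)[OF Vh(2)] Vh_H1(2)[OF \<delta>_Vh] Vh_H1(2)[OF prev_in]
  have grad_L2: "grad \<Omega> v \<in> L2 \<Omega>" if "v \<in> H1 \<Omega>" for v
    using has_weak_grad_grad[OF that] by (simp add: has_weak_grad_def)
  have z_H1: "z \<in> H1 \<Omega>"
  proof -
    have "z = (\<lambda>x. e \<bullet> x)" using height(2) by auto
    moreover obtain R where R: "\<And>x. x \<in> \<Omega> \<Longrightarrow> norm x \<le> R" using \<Omega>(2) by (auto simp: bounded_iff)
    have "(\<lambda>x. e \<bullet> x) \<in> L2 \<Omega>"
    proof (rule L2_bounded[OF m])
      show "(\<lambda>x. e \<bullet> x) \<in> borel_measurable ?M"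
        by (intro continuous_lebesgue_on_measurable continuous_intros)
      show "norm (e \<bullet> x) \<le> R" if "x \<in> \<Omega>" for x
        using Cauchy_Schwarz_ineq2[of e x] R[OF that] height(1) by simp
    qed
    ultimately show ?thesis using has_weak_grad_linear[OF \<Omega>] by (auto simp: H1_def)
  qed
  have uz_H1: "(\<lambda>y. u y + z y) \<in> H1 \<Omega>"
    using grad_linear_combination_AE(1)[OF \<Omega> Vh_H1(1)[OF Vh(1)] z_H1, of 1] by simp
  have gu_L2: "gu \<in> L2 \<Omega>" and g\<delta>_L2: "g\<delta> \<in> L2 \<Omega>"
    unfolding gu_def g\<delta>_def by (intro grad_L2 uz_H1 Vh_H1 \<delta>_Vh)+
  have \<sigma>_L2: "\<sigma> \<in> L2 \<Omega>" using sigma_in by (simp add: Hdiv_def)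

  have \<theta>01: "\<theta> s \<in> {0..1}" for s using theta(1) rangeI[of \<theta> s] by (rule subsetD)
  have Asym: "transpose (K (\<theta> s)) = K (\<theta> s)" for s by (rule K_sym[OF \<theta>01])
  have Apsd: "0 \<le> y \<bullet> (K (\<theta> s) *v y)" for s y
    using K_bounds(1)[OF \<theta>01, of y s] kappa(1) by (meson mult_nonneg_nonneg order_trans zero_le_power2)
  have Abound: "norm (K (\<theta> s) *v y) \<le> \<kappa>M * norm y" for s y
    using kappa by (intro psd_matrix_norm_bound Asym Apsd K_bounds(2)[OF \<theta>01]) auto
  have meas_comp: "(\<lambda>x. h (v x)) \<in> borel_measurable ?M" if "continuous_on UNIV h" "v \<in> L2 \<Omega>"
    for h :: "real \<Rightarrow> 'b::euclidean_space" and v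
    using measurable_compose[OF L2_measurable[OF that(2)] borel_measurable_continuous_onI[OF that(1)]] .
  have \<theta>_L2: "(\<lambda>x. \<theta> (v x)) \<in> L2 \<Omega>" if "v \<in> L2 \<Omega>" for v
  proof (rule L2_bounded[OF m])
    show "(\<lambda>x. \<theta> (v x)) \<in> borel_measurable ?M"
      using lipschitz_on_continuous_on[OF theta(2)] that by (rule meas_comp)
    show "norm (\<theta> (v x)) \<le> 1" for x using \<theta>01[of "v x"] by simp
  qed
  have A_meas: "(\<lambda>x. K (\<theta> (v x))) \<in> borel_measurable ?M" if "v \<in> L2 \<Omega>" for v
    using meas_comp[OF lipschitz_on_continuous_on[OF K_lipschitz] that] by simp
  have A_L2: "(\<lambda>x. K (\<theta> (v x)) *v g x) \<in> L2 \<Omega>" if "v \<in> L2 \<Omega>" "g \<in> L2 \<Omega>" for v g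
    using A_meas[OF that(1)] that(2) Abound by (rule L2_matrix_field)
  note AL2 = A_L2[OF L2s(1) gu_L2, folded A_def] A_L2[OF L2s(2) gu_L2, folded A0_def]
    A_L2[OF L2s(1) g\<delta>_L2, folded A_def]
  have \<theta>'_meas: "(\<lambda>x. \<theta>' (u x)) \<in> borel_measurable ?M"
    using measurable_compose[OF L2_measurable[OF L2s(1)] theta_deriv(1)] .
  have \<theta>'_nonneg: "0 \<le> \<theta>' s" for s using theta_deriv(3,4) order_trans by blast
  have \<theta>'\<delta>_L2: "(\<lambda>x. \<theta>' (u x) * \<delta> x) \<in> L2 \<Omega>"
    using L2s(3)
  proof (rule L2_dominated)
    show "(\<lambda>x. \<theta>' (u x) * \<delta> x) \<in> borel_measurable ?M"
      by (intro borel_measurable_times \<theta>'_meas L2_measurable L2s)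
    show "AE x in ?M. norm (\<theta>' (u x) * \<delta> x) \<le> L\<theta> * norm (\<delta> x)"
      using theta_deriv(5) \<theta>'_nonneg by (auto simp: abs_mult intro!: AE_I2 mult_right_mono)
  qed
  have H_meas: "H \<in> borel_measurable ?M"
    unfolding H_def
    by (intro borel_measurable_matrix_vector_mult L2_measurable[OF gu_L2]
        measurable_compose[OF L2_measurable[OF L2s(1)] K_deriv(1)])
  have r_L2: "r \<in> L2 \<Omega>"
    using L2_diff[OF L2_scaleR[OF L2_diff[OF L2s(1,2)], of L] L2_diff[OF L2s(1,2)[THEN \<theta>_L2]]]
    by (simp add: r_def L_residual_def[abs_def])
  have G_L2: "G \<in> L2 \<Omega>"
    using L2_add[OF L2_diff[OF AL2(1,2)] \<sigma>_L2] by (simp add: G_def[abs_def] matrix_vector_mult_diff_rdistrib)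

  define N1 where "N1 x = \<theta>' (u x) * (\<delta> x)\<^sup>2" for x
  define N2 where "N2 x = g\<delta> x \<bullet> (A x *v g\<delta> x)" for x
  define a where "a x = indicator (- \<Union>D) x * r x * \<delta> x" for x
  define b where "b x = - (G x \<bullet> g\<delta> x)" for x
  define d where "d x = - \<tau> * (\<delta> x * (H x \<bullet> g\<delta> x))" for x

  have N1: "integrable ?M N1"
    using L2_inner_integrable[OF \<theta>'\<delta>_L2 L2s(3)] by (simp add: N1_def[abs_def] power2_eq_square mult.assoc)
  have N2: "integrable ?M N2"
    using L2_inner_integrable[OF g\<delta>_L2 AL2(3)] by (simp add: N2_def[abs_def])
  have b_int: "integrable ?M b"
    using L2_inner_integrable[OF G_L2 g\<delta>_L2] by (simp add: b_def[abs_def])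
  have finD: "finite D" "D \<subseteq> \<T>"
    using mesh_elements(1)[OF mesh] by (auto simp: D_def degenerate_elements_def)
  have closedD: "closed (\<Union>D)" "closed (\<Union>(\<T> - D))"
    using finD mesh_elements[OF mesh] by (auto intro!: closed_Union compact_imp_closed)
  have "(indicator S :: _ \<Rightarrow> real) \<in> borel_measurable ?M" if "S \<in> sets borel" for S :: "(real^'d) set"
    by (rule measurable_restrict_space1, rule measurable_completion) (use that in simp)
  from this[of "\<Union>D"] this[of "- \<Union>D"]
  have D_meas: "(indicator (\<Union>D) :: _ \<Rightarrow> real) \<in> borel_measurable ?M"
      "(indicator (- \<Union>D) :: _ \<Rightarrow> real) \<in> borel_measurable ?M"
    using closedD(1) by auto
  have ind_L2: "(\<lambda>x. indicator S x * v x) \<in> L2 \<Omega>"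
    if v: "v \<in> L2 \<Omega>" and S: "(indicator S :: _ \<Rightarrow> real) \<in> borel_measurable ?M" for v :: "real^'d \<Rightarrow> real" and S
    using v
  proof (rule L2_dominated)
    show "(\<lambda>x. indicator S x * v x) \<in> borel_measurable ?M"
      by (rule borel_measurable_times[OF S L2_measurable[OF v]])
    show "AE x in ?M. norm (indicator S x * v x) \<le> 1 * norm (v x)" by (simp add: indicator_def)
  qed
  have a_int: "integrable ?M a"
    using L2_inner_integrable[OF ind_L2[OF r_L2 D_meas(2)] L2s(3)] by (simp add: a_def[abs_def])

  have split: "x \<bullet> y = (matrix_inv_sqrt (A t) *v x) \<bullet> (matrix_sqrt (A t) *v y)"
    if "invertible (matrix_sqrt (A t))" for t x y
    using that unfolding A_def by (intro inner_matrix_sqrt_split Asym Apsd)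
  have norm_sqrt: "(norm (matrix_sqrt (A t) *v y))\<^sup>2 = y \<bullet> (A t *v y)" for t y
    unfolding A_def by (intro norm_matrix_sqrt Asym Apsd)
  have inv: "AE x in ?M. invertible (matrix_sqrt (A x))" using K_inv_sqrt by (simp add: A_def u_def)
  have C_AE: "AE x in ?M. \<tau> * (norm (matrix_inv_sqrt (A x) *v H x))\<^sup>2 \<le> C\<^sub>N\<^sup>2 * \<theta>' (u x)"
    using C_bound by (simp add: A_def H_def gu_def u_def)

  \<comment> \<open>The hypothesis on \<open>C\<^sub>N\<close>: the derivative of the permeability costs the fraction \<open>C\<^sub>N / 2\<close> of the energy.\<close>
  have d_abs: "AE x in ?M. \<bar>d x\<bar> \<le> (1 - c) * (N1 x + \<tau> * N2 x)"
    using inv C_AE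
  proof eventually_elim
    case (elim x)
    let ?h = "matrix_inv_sqrt (A x) *v H x" and ?q = "matrix_sqrt (A x) *v g\<delta> x"
    have "(sqrt \<tau> * norm ?h)\<^sup>2 \<le> (C\<^sub>N * sqrt (\<theta>' (u x)))\<^sup>2"
      using elim(2) params(2) \<theta>'_nonneg by (simp add: power_mult_distrib)
    then have h: "sqrt \<tau> * norm ?h \<le> C\<^sub>N * sqrt (\<theta>' (u x))"
      by (rule power2_le_imp_le) (use C_range \<theta>'_nonneg in auto)
    have "\<bar>d x\<bar> = \<tau> * \<bar>\<delta> x\<bar> * \<bar>?h \<bullet> ?q\<bar>"
      using split[OF elim(1)] params(2) by (simp add: d_def abs_mult)
    also have "\<dots> \<le> \<tau> * \<bar>\<delta> x\<bar> * (norm ?h * norm ?q)"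
      using params(2) by (intro mult_left_mono Cauchy_Schwarz_ineq2) auto
    also have "\<dots> = (sqrt \<tau> * norm ?h) * (\<bar>\<delta> x\<bar> * (sqrt \<tau> * norm ?q))"
      using params(2) by (simp add: mult_ac flip: mult.assoc[of "sqrt \<tau>" "sqrt \<tau>"])
    also have "\<dots> \<le> (C\<^sub>N * sqrt (\<theta>' (u x))) * (\<bar>\<delta> x\<bar> * (sqrt \<tau> * norm ?q))"
      using params(2) by (intro mult_right_mono h) auto
    also have "\<dots> = C\<^sub>N * ((sqrt (\<theta>' (u x)) * \<bar>\<delta> x\<bar>) * (sqrt \<tau> * norm ?q))" by simp
    also have "\<dots> \<le> C\<^sub>N * (((sqrt (\<theta>' (u x)) * \<bar>\<delta> x\<bar>)\<^sup>2 + (sqrt \<tau> * norm ?q)\<^sup>2) / 2)"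
      using C_range(1) sum_squares_bound[of "sqrt (\<theta>' (u x)) * \<bar>\<delta> x\<bar>" "sqrt \<tau> * norm ?q"]
      by (intro mult_left_mono) auto
    also have "\<dots> = (1 - c) * (N1 x + \<tau> * N2 x)"
      using params(2) \<theta>'_nonneg by (simp add: c_def N1_def N2_def power_mult_distrib norm_sqrt)
    finally show ?case .
  qed
  have d_int: "integrable ?M d"
  proof (rule Bochner_Integration.integrable_bound)
    show "integrable ?M (\<lambda>x. (1 - c) * (N1 x + \<tau> * N2 x))" using N1 N2 by simp
    show "d \<in> borel_measurable ?M"
      unfolding d_def by (intro borel_measurable_times borel_measurable_inner borel_measurable_const
          L2_measurable L2s g\<delta>_L2 H_meas)
    show "AE x in ?M. norm (d x) \<le> norm ((1 - c) * (N1 x + \<tau> * N2 x))"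
      using d_abs by eventually_elim simp
  qed

  \<comment> \<open>On nondegenerate elements \<open>\<theta>'\<close> is at least \<open>\<epsilon>\<close>, so that division by its root is legitimate.\<close>
  have a_AE: "AE x in ?M. ennreal (2 * c * a x - c\<^sup>2 * N1 x) \<le>
      indicator (\<Union>(\<T> - D)) x * ennreal ((norm (\<theta>' (u x) powr (- 1 / 2) * r x))\<^sup>2)"
  proof (rule AE_I2)
    fix x assume "x \<in> space ?M"
    then have "x \<in> \<Union>\<T>" using mesh closure_subset[of \<Omega>] by (auto simp: mesh_of_def space_restrict_space)
    show "ennreal (2 * c * a x - c\<^sup>2 * N1 x) \<le>
      indicator (\<Union>(\<T> - D)) x * ennreal ((norm (\<theta>' (u x) powr (- 1 / 2) * r x))\<^sup>2)"
    proof (cases "x \<in> \<Union>D")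
      case True
      then show ?thesis using \<theta>'_nonneg by (simp add: a_def N1_def ennreal_neg)
    next
      case False
      then obtain E where E: "E \<in> \<T> - D" "x \<in> E" using \<open>x \<in> \<Union>\<T>\<close> by blast
      have "bdd_below ((\<lambda>x. \<theta>' (u x)) ` E)" by (rule bdd_belowI[of _ 0]) (use \<theta>'_nonneg in auto)
      then have "(INF x\<in>E. \<theta>' (u x)) \<le> \<theta>' (u x)" using E(2) by (rule cINF_lower)
      moreover have "\<epsilon> \<le> (INF x\<in>E. \<theta>' (u x))" using E(1) by (auto simp: D_def degenerate_elements_def)
      ultimately have pos: "0 < \<theta>' (u x)" using params(3) by linarith
      let ?s = "sqrt (\<theta>' (u x))" and ?w = "\<theta>' (u x) powr (- 1 / 2) * r x"
      have "\<theta>' (u x) powr (- 1 / 2) = 1 / ?s"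
        using pos by (simp add: powr_minus_divide powr_half_sqrt)
      then have ws: "?w * ?s = r x" using pos by simp
      have "2 * ?w * (c * (?s * \<delta> x)) \<le> ?w\<^sup>2 + (c * (?s * \<delta> x))\<^sup>2" by (rule sum_squares_bound)
      moreover have "2 * ?w * (c * (?s * \<delta> x)) = 2 * c * a x"
      proof -
        have "a x = r x * \<delta> x" using False by (simp add: a_def)
        also have "\<dots> = (?w * ?s) * \<delta> x" by (simp only: ws)
        finally show ?thesis by (simp only: mult_ac)
      qed
      moreover have "(c * (?s * \<delta> x))\<^sup>2 = c\<^sup>2 * N1 x"
        using pos by (simp add: N1_def power_mult_distrib)
      ultimately have "2 * c * a x - c\<^sup>2 * N1 x \<le> (norm ?w)\<^sup>2"
        unfolding real_norm_def power2_abs by linarith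
      then have "ennreal (2 * c * a x - c\<^sup>2 * N1 x) \<le> ennreal ((norm ?w)\<^sup>2)" by (rule ennreal_leI)
      moreover have "x \<in> \<Union>(\<T> - D)" using E by blast
      ultimately show ?thesis by (simp only: indicator_simps mult_1)
    qed
  qed
  have b_AE: "AE x in ?M. ennreal (2 * c * b x - c\<^sup>2 * N2 x) \<le>
      ennreal ((norm (matrix_inv_sqrt (A x) *v G x))\<^sup>2)"
    using inv
  proof eventually_elim
    case (elim x)
    let ?g = "matrix_inv_sqrt (A x) *v G x" and ?q = "matrix_sqrt (A x) *v g\<delta> x"
    have "0 \<le> (norm (?g + c *\<^sub>R ?q))\<^sup>2" by simp
    also have "\<dots> = (norm ?g)\<^sup>2 + 2 * c * (?g \<bullet> ?q) + c\<^sup>2 * (norm ?q)\<^sup>2"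
      unfolding power2_norm_eq_inner by (simp add: algebra_simps inner_commute power2_eq_square)
    also have "\<dots> = (norm ?g)\<^sup>2 - (2 * c * b x - c\<^sup>2 * N2 x)"
      using split[OF elim, of "G x" "g\<delta> x"] by (simp add: b_def N2_def norm_sqrt)
    finally show ?case by (intro ennreal_leI) simp
  qed

  \<comment> \<open>Newton step minus L-scheme step, tested with the increment; the source and the previous time step cancel.\<close>
  have identity: "integral\<^sup>L ?M N1 + \<tau> * integral\<^sup>L ?M N2 =
      integral\<^sup>L ?M a + \<tau> * integral\<^sup>L ?M b + integral\<^sup>L ?M d"
  proof -
    let ?f = "f (real n * \<tau>)"
    have N: "L2_inner \<Omega> (\<lambda>x. \<theta>' (u x) * \<delta> x) \<delta>
        + \<tau> * L2_inner \<Omega> (\<lambda>x. A x *v grad \<Omega> (\<lambda>y. \<psi>N y + z y) x) g\<delta>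
        + \<tau> * L2_inner \<Omega> (\<lambda>x. \<delta> x *\<^sub>R H x) g\<delta>
        = \<tau> * L2_inner \<Omega> ?f \<delta> - L2_inner \<Omega> (\<lambda>x. \<theta> (u x) - \<theta> (\<psi>prev x)) \<delta>"
      using newton \<delta>_Vh unfolding Newton_step_def u_def[symmetric]
      by (simp add: A_def[abs_def] H_def[abs_def] gu_def g\<delta>_def \<delta>_def[abs_def])
    have Ls: "L * L2_inner \<Omega> (\<lambda>x. u x - u0 x) \<delta> + \<tau> * L2_inner \<Omega> (\<lambda>x. A0 x *v gu x) g\<delta>
        = \<tau> * L2_inner \<Omega> ?f \<delta> - L2_inner \<Omega> (\<lambda>x. \<theta> (u0 x) - \<theta> (\<psi>prev x)) \<delta>"
      using L_scheme[of i] params(4) \<delta>_Vh unfolding L_scheme_step_def u_def[symmetric] u0_def[symmetric]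
      by (simp add: A0_def[abs_def] gu_def g\<delta>_def)
    have i: "integral\<^sup>L ?M N1 = L2_inner \<Omega> (\<lambda>x. \<theta>' (u x) * \<delta> x) \<delta>"
        "integral\<^sup>L ?M d = - \<tau> * L2_inner \<Omega> (\<lambda>x. \<delta> x *\<^sub>R H x) g\<delta>"
        "integral\<^sup>L ?M a = L2_inner \<Omega> (\<lambda>x. indicator (- \<Union>D) x * r x) \<delta>"
        "integral\<^sup>L ?M b = - L2_inner \<Omega> G g\<delta>"
        "integral\<^sup>L ?M N2 = L2_inner \<Omega> (\<lambda>x. A x *v g\<delta> x) g\<delta>"
      unfolding L2_inner_def N1_def d_def a_def b_def N2_def
      by (simp_all add: power2_eq_square mult.assoc inner_commute)
    have add: "L2_inner \<Omega> (\<lambda>x. v x + w x) h = L2_inner \<Omega> v h + L2_inner \<Omega> w h"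
      and diff: "L2_inner \<Omega> (\<lambda>x. v x - w x) h = L2_inner \<Omega> v h - L2_inner \<Omega> w h"
      if "v \<in> L2 \<Omega>" "w \<in> L2 \<Omega>" "h \<in> L2 \<Omega>" for v w h :: "real^'d \<Rightarrow> 'b::euclidean_space"
      unfolding L2_inner_def inner_add_left inner_diff_left
      by (intro Bochner_Integration.integral_add Bochner_Integration.integral_diff
          L2_inner_integrable that)+
    have "L2_inner \<Omega> (\<lambda>x. A x *v grad \<Omega> (\<lambda>y. \<psi>N y + z y) x) g\<delta>
        = L2_inner \<Omega> (\<lambda>x. A x *v gu x + A x *v g\<delta> x) g\<delta>"
    proof -
      \<comment> \<open>The factor \<open>1\<close> brings the sum into the form of the linearity lemma.\<close>
      have eq: "(\<lambda>y. \<psi>N y + z y) = (\<lambda>y. (u y + z y) + 1 * \<delta> y)" by (auto simp: \<delta>_def)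
      note lin = grad_linear_combination_AE[OF \<Omega> uz_H1 Vh_H1(1)[OF \<delta>_Vh], of 1, folded eq]
      have "AE x in ?M. A x *v grad \<Omega> (\<lambda>y. \<psi>N y + z y) x = A x *v gu x + A x *v g\<delta> x"
        using lin(2) by eventually_elim (simp add: gu_def g\<delta>_def matrix_vector_right_distrib)
      then show ?thesis
        unfolding L2_inner_def using A_L2[OF L2s(1) grad_L2[OF lin(1)]] L2_add[OF AL2(1,3)] g\<delta>_L2
        by (intro integral_cong_AE borel_measurable_inner L2_measurable) (auto simp: A_def)
    qed
    also have "\<dots> = L2_inner \<Omega> (\<lambda>x. A x *v gu x) g\<delta> + L2_inner \<Omega> (\<lambda>x. A x *v g\<delta> x) g\<delta>"
      by (rule add[OF AL2(1,3) g\<delta>_L2])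
    finally have F1: "L2_inner \<Omega> (\<lambda>x. A x *v grad \<Omega> (\<lambda>y. \<psi>N y + z y) x) g\<delta>
        = L2_inner \<Omega> (\<lambda>x. A x *v gu x) g\<delta> + L2_inner \<Omega> (\<lambda>x. A x *v g\<delta> x) g\<delta>" .
    have F2: "L2_inner \<Omega> r \<delta> = L * L2_inner \<Omega> (\<lambda>x. u x - u0 x) \<delta>
        - (L2_inner \<Omega> (\<lambda>x. \<theta> (u x) - \<theta> (\<psi>prev x)) \<delta> - L2_inner \<Omega> (\<lambda>x. \<theta> (u0 x) - \<theta> (\<psi>prev x)) \<delta>)"
    proof -
      have "r = (\<lambda>x. L *\<^sub>R (u x - u0 x) - (\<theta> (u x) - \<theta> (u0 x)))"
        by (auto simp: r_def L_residual_def)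
      then have "L2_inner \<Omega> r \<delta> = L2_inner \<Omega> (\<lambda>x. L *\<^sub>R (u x - u0 x)) \<delta>
          - L2_inner \<Omega> (\<lambda>x. \<theta> (u x) - \<theta> (u0 x)) \<delta>"
        using diff[OF L2_scaleR[OF L2_diff[OF L2s(1,2)]] L2_diff[OF L2s(1,2)[THEN \<theta>_L2]] L2s(3)]
        by simp
      also have "L2_inner \<Omega> (\<lambda>x. L *\<^sub>R (u x - u0 x)) \<delta> = L * L2_inner \<Omega> (\<lambda>x. u x - u0 x) \<delta>"
        by (simp add: L2_inner_def mult.assoc)
      finally show ?thesis using diff[OF _ _ L2s(3)] \<theta>_L2 L2s by simp
    qed
    have F3: "L2_inner \<Omega> r \<delta> = L2_inner \<Omega> r (\<lambda>x. indicator (\<Union>D) x * \<delta> x)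
        + L2_inner \<Omega> (\<lambda>x. indicator (- \<Union>D) x * r x) \<delta>"
    proof -
      have "L2_inner \<Omega> r (\<lambda>x. indicator (\<Union>D) x * \<delta> x)
          + L2_inner \<Omega> (\<lambda>x. indicator (- \<Union>D) x * r x) \<delta>
        = (\<integral>x. r x \<bullet> (indicator (\<Union>D) x * \<delta> x) + (indicator (- \<Union>D) x * r x) \<bullet> \<delta> x \<partial>?M)"
        unfolding L2_inner_def
        by (intro Bochner_Integration.integral_add[symmetric] L2_inner_integrable ind_L2 r_L2 L2s D_meas)
      also have "\<dots> = L2_inner \<Omega> r \<delta>"
        unfolding L2_inner_def by (intro Bochner_Integration.integral_cong) (auto simp: indicator_def)
      finally show ?thesis by simp
    qed
    \<comment> \<open>The degenerate part of the residual becomes a flux: projection, divergence equation, integration by parts.\<close>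
    have F4: "L2_inner \<Omega> r (\<lambda>x. indicator (\<Union>D) x * \<delta> x) = - \<tau> * L2_inner \<Omega> \<sigma> g\<delta>"
    proof -
      let ?g = "\<lambda>x. if x \<in> \<Union>D then 1 / \<tau> * Proj r x else 0"
      have "L2_inner \<Omega> r (\<lambda>x. indicator (\<Union>D) x * \<delta> x)
          = L2_inner \<Omega> (Proj r) (\<lambda>x. indicator (\<Union>D) x * \<delta> x)"
        using proj r_L2 Vh_cutoff_broken_poly[OF mesh \<delta>_Vh finD(2)] by (simp add: is_L2_projection_def)
      also have "\<dots> = (\<integral>x. \<tau> * (?g x \<bullet> \<delta> x) \<partial>?M)"
        unfolding L2_inner_def using params(2)
        by (intro Bochner_Integration.integral_cong) (auto simp: indicator_def)
      also have "\<dots> = \<tau> * L2_inner \<Omega> ?g \<delta>" by (simp add: L2_inner_def)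
      also have "L2_inner \<Omega> ?g \<delta> = - L2_inner \<Omega> \<sigma> g\<delta>"
      proof -
        have "\<delta> \<in> H10 \<Omega>" using \<delta>_Vh by (simp add: Vh_def)
        from weak_div_H10[OF \<Omega> \<sigma>_L2 sigma_div[folded u_def u0_def, folded r_def D_def] this]
        show ?thesis unfolding g\<delta>_def by linarith
      qed
      finally show ?thesis by simp
    qed
    have F5: "L2_inner \<Omega> G g\<delta> = L2_inner \<Omega> (\<lambda>x. A x *v gu x) g\<delta>
        - L2_inner \<Omega> (\<lambda>x. A0 x *v gu x) g\<delta> + L2_inner \<Omega> \<sigma> g\<delta>"
      using add[OF L2_diff[OF AL2(1,2)] \<sigma>_L2 g\<delta>_L2] diff[OF AL2(1,2) g\<delta>_L2]
      by (simp add: G_def[abs_def] matrix_vector_mult_diff_rdistrib)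
    show ?thesis using N Ls unfolding i F1 F5 using F2 F3 F4 by (simp add: algebra_simps)
  qed

  define X where "X = integral\<^sup>L ?M N1 + \<tau> * integral\<^sup>L ?M N2"
  have N_nonneg: "0 \<le> N1 x" "0 \<le> N2 x" for x
    using \<theta>'_nonneg Apsd by (auto simp: N1_def N2_def A_def)
  have X_nonneg: "0 \<le> X"
    unfolding X_def using params(2) N_nonneg
    by (intro add_nonneg_nonneg mult_nonneg_nonneg Bochner_Integration.integral_nonneg) auto
  have "newton_norm \<Omega> \<theta> \<theta>' K \<tau> u \<delta> = esqrt (\<integral>\<^sup>+x. ennreal (N1 x + \<tau> * N2 x) \<partial>?M)"
    unfolding newton_norm_def using norm_sqrt by (simp add: N1_def N2_def A_def g\<delta>_def)
  also have "(\<integral>\<^sup>+x. ennreal (N1 x + \<tau> * N2 x) \<partial>?M) = ennreal X"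
    unfolding X_def using N1 N2 N_nonneg params(2) by (subst nn_integral_eq_integral) auto
  also have "esqrt (ennreal X) = ennreal (1 / c * (c * sqrt X))"
    using c X_nonneg by (simp add: esqrt_ennreal)
  also have "\<dots> = ennreal (1 / c) * esqrt (ennreal (c\<^sup>2 * X))"
    using c X_nonneg by (simp add: esqrt_ennreal real_sqrt_mult flip: ennreal_mult)
  also have "\<dots> \<le> ennreal (1 / c) * esqrt ((eta_poten \<T> \<theta> \<theta>' L \<epsilon> u0 u)\<^sup>2 + ennreal \<tau> * (eta_flux \<Omega> \<theta> K z \<sigma> u0 u)\<^sup>2)"
  proof (intro mult_left_mono esqrt_mono)
    have "ennreal (c\<^sup>2 * X) \<le>
        (\<integral>\<^sup>+x. indicator (\<Union>(\<T> - D)) x * ennreal ((norm (\<theta>' (u x) powr (- 1 / 2) * r x))\<^sup>2) \<partial>?M)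
        + ennreal \<tau> * (\<integral>\<^sup>+x. ennreal ((norm (matrix_inv_sqrt (A x) *v G x))\<^sup>2) \<partial>?M)"
      unfolding X_def
    proof (rule absorbed_energy_bound[OF N1 N2 a_int b_int d_int _ c identity _ a_AE b_AE])
      show "AE x in ?M. d x \<le> (1 - c) * (N1 x + \<tau> * N2 x)"
        using d_abs by eventually_elim simp
    qed (use params(2) in simp)
    also have "\<dots> \<le> (eta_poten \<T> \<theta> \<theta>' L \<epsilon> u0 u)\<^sup>2 + ennreal \<tau> * (eta_flux \<Omega> \<theta> K z \<sigma> u0 u)\<^sup>2"
    proof (intro add_mono mult_left_mono)
      show "(\<integral>\<^sup>+x. indicator (\<Union>(\<T> - D)) x * ennreal ((norm (\<theta>' (u x) powr (- 1 / 2) * r x))\<^sup>2) \<partial>?M)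
          \<le> (eta_poten \<T> \<theta> \<theta>' L \<epsilon> u0 u)\<^sup>2"
        unfolding eta_poten_def L2_normD D_def[symmetric] r_def[symmetric]
        using closedD(2) by (intro nn_integral_indicator_lebesgue_on_le \<Omega>_sets) auto
    qed (simp_all add: eta_flux_def L2_normD G_def A_def A0_def gu_def)
    finally show "ennreal (c\<^sup>2 * X) \<le> (eta_poten \<T> \<theta> \<theta>' L \<epsilon> u0 u)\<^sup>2 + ennreal \<tau> * (eta_flux \<Omega> \<theta> K z \<sigma> u0 u)\<^sup>2" .
  qed auto
  also have "1 / c = 2 / (2 - C\<^sub>N)" using C_range by (simp add: c_def field_simps)
  finally show ?thesis
    unfolding eta_L_to_N_def by (simp add: u_def u0_def \<delta>_def[abs_def])
qed

end
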